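(* Let $d\ge2$ and $K\ge1$, and let $P_\tau$ be a probability distribution on $[0,\infty)$ not concentrated at a single point. Let $\tau_e$ have distribution $P_\tau$ and let $Y_{2d}$ be the minimum of $2d$ independent random variables with distribution $P_\tau$. Assume that $E[\tau_e]<\infty$, or that $K\ge3$ and $E[Y_{2d}]<\infty$. Let $\mu_K$ denote the time constant of first-passage percolation on the $(K,d)$-tube with i.i.d. passage times of distribution $P_\tau$. Then $$\mu_{K+1}<\mu_K.$$
   Context: The $(K,d)$-tube is the nearest neighbour graph on $\mathbb{Z}\times\{0,1,\dots,K-1\}^{d-1}$. Its edges carry i.i.d. non-negative passage times $\tau_e$ with distribution $P_\tau$. For a path $\Gamma$ (alternating sequence of vertices and edges), $T(\Gamma)=\sum_{e\in\Gamma}\tau_e$, and $T_K(u,v)$ is the infimum of $T(\Gamma)$ over paths $\Gamma$ from $u$ to $v$ in the $(K,d)$-tube. The time constant $\mu_K\in[0,\infty)$ is the deterministic limit $\mu_K=\lim_{n\to\infty}\frac1nT_K(\mathbf{0},n\mathbf{e}_1)$, $\mathbf{e}_1=(1,0,\dots,0)$, which exists in probability under the stated moment assumptions (and almost surely and in $L^1$ when $E[\tau_e]<\infty$).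
   Formalization: The time constant may equal +∞ (limit in probability in the extended reals): for d=2, K=3, E[Y_4]<∞ but the minimum of 3 independent passage times has infinite mean, no finite μ_3 exists and the claim reads μ_4<∞=μ_3; in all other cases μ_K is as stated. *)

theory Defs
  imports "HOL-Probability.Probability"
begin

text \<open>
  A point of \<open>\<int>\<^sup>d\<close> is a function \<open>nat \<Rightarrow> int\<close> that vanishes on all indices \<open>\<ge> d\<close>; index 0 is the
  unbounded direction of the tube, the direction of \<open>e\<^sub>1\<close>.
\<close>

type_synonym vertex = "nat \<Rightarrow> int"

definition tube_vertices :: "nat \<Rightarrow> nat \<Rightarrow> vertex set" where
  "tube_vertices d K = {x. (\<forall>i\<in>{1..<d}. x i \<in> {0..<int K}) \<and> (\<forall>i\<ge>d. x i = 0)}"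

definition neighbours :: "nat \<Rightarrow> vertex \<Rightarrow> vertex \<Rightarrow> bool" where
  "neighbours d x y \<longleftrightarrow> (\<Sum>i<d. \<bar>x i - y i\<bar>) = 1"

definition tube_edges :: "nat \<Rightarrow> nat \<Rightarrow> vertex set set" where
  "tube_edges d K =
     {{x, y} |x y. x \<in> tube_vertices d K \<and> y \<in> tube_vertices d K \<and> neighbours d x y}"

text \<open>
  The graph is simple, so a path is determined by its sequence of vertices. Vertices and edges may
  repeat; a repeated edge is counted each time it is traversed.
\<close>

definition tube_paths :: "nat \<Rightarrow> nat \<Rightarrow> vertex \<Rightarrow> vertex \<Rightarrow> vertex list set" where
  "tube_paths d K u v =
     {p. p \<noteq> [] \<and> hd p = u \<and> last p = v \<and> set p \<subseteq> tube_vertices d K \<and>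
         successively (neighbours d) p}"

definition path_edges :: "vertex list \<Rightarrow> vertex set list" where
  "path_edges p = map2 (\<lambda>x y. {x, y}) p (tl p)"

definition path_time :: "(vertex set \<Rightarrow> real) \<Rightarrow> vertex list \<Rightarrow> real" where
  "path_time \<tau> p = (\<Sum>e\<leftarrow>path_edges p. \<tau> e)"

definition passage_time ::
    "nat \<Rightarrow> nat \<Rightarrow> (vertex set \<Rightarrow> real) \<Rightarrow> vertex \<Rightarrow> vertex \<Rightarrow> real" where
  "passage_time d K \<tau> u v = (INF p\<in>tube_paths d K u v. path_time \<tau> p)"

definition axis_point :: "nat \<Rightarrow> vertex" where
  "axis_point n = (\<lambda>i. if i = 0 then int n else 0)"

text \<open>
  Convergence in probability to a constant in \<open>[-\<infinity>,\<infinity>]\<close>. For a finite limit \<open>c\<close> the neighbourhoods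
  may be taken to be the balls around \<open>c\<close>, which is the usual condition \<open>P(\<bar>X\<^sub>n - c\<bar> \<ge> \<epsilon>) \<longlongrightarrow> 0\<close>
  for all \<open>\<epsilon> > 0\<close>. The limit \<open>\<infinity>\<close> has to be allowed: if \<open>d = 2\<close>, \<open>K = 3\<close>, the minimum of four passage
  times is integrable but that of three is not, then crossing the columns of three parallel edges
  already forces \<open>T\<^sub>K(0, n e\<^sub>1) / n \<longlongrightarrow> \<infinity>\<close>.
\<close>

definition tendsto_in_prob :: "'a measure \<Rightarrow> (nat \<Rightarrow> 'a \<Rightarrow> real) \<Rightarrow> ereal \<Rightarrow> bool" where
  "tendsto_in_prob M X c \<longleftrightarrow>
     (\<forall>n. X n \<in> borel_measurable M) \<and>
     (\<forall>U. open U \<and> c \<in> U \<longrightarrow>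
        (\<lambda>n. measure M {\<omega> \<in> space M. ereal (X n \<omega>) \<notin> U}) \<longlonglongrightarrow> 0)"

text \<open>
  The i.i.d. passage times are realised as the coordinates of the product measure over the edges.
\<close>

definition fpp_measure :: "nat \<Rightarrow> nat \<Rightarrow> real measure \<Rightarrow> (vertex set \<Rightarrow> real) measure" where
  "fpp_measure d K P = (\<Pi>\<^sub>M e\<in>tube_edges d K. P)"

definition time_constant :: "nat \<Rightarrow> nat \<Rightarrow> real measure \<Rightarrow> ereal" where
  "time_constant d K P =
     (THE \<mu>. tendsto_in_prob (fpp_measure d K P)
        (\<lambda>n \<tau>. passage_time d K \<tau> (axis_point 0) (axis_point n) / real n) \<mu>)"

end

theory Submission
  imports Defs
begin

text \<open>
  The narrow tube sits inside the wide one, whose extra layers offer shortcuts. Suppose that along a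
  stretch of length \<open>L\<close> every lengthwise edge of the narrow tube costs at least \<open>b\<close>, while all edges
  across it and all edges outside the narrow tube cost at most \<open>a < b\<close>. A path that stays in the
  narrow tube has to pay \<open>L b\<close> for this stretch; in the wide tube one can step to the extra layer,
  run along it and step back for \<open>L a\<close> plus a constant, which is cheaper by at least \<open>1\<close> if \<open>L\<close> is
  large (\<open>shortcutI\<close>). Only finitely many edges are involved, so a stretch has this property with a
  probability \<open>p > 0\<close>. The savings of consecutive stretches add up (\<open>pdist_add_shortcuts_le\<close>), and
  by Markov's inequality at least \<open>m p / 2\<close> of the first \<open>m\<close> stretches can be used with probability
  at least \<open>p / 2\<close>. Since the passage times divided by the distance converge in probability in both
  tubes, one environment in which both are close to their limits and in which there are that many
  shortcuts is enough to separate the limits by about \<open>p / (2 L)\<close> (\<open>rate_strict_antimono\<close>).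

  The limit is identified through the time \<open>cross\<close> that a path needs inside a slab in order to get
  from its left to its right side. Crossing times of adjacent slabs are independent, and they are
  superadditive: \<open>cross\<close> of a long slab is at least the sum over its blocks. With \<open>rate\<close> the
  supremum of the mean crossing times per unit length, Hoeffding's inequality for the truncated
  block crossing times shows that crossing times are rarely below any \<open>c < rate\<close>. The upper bound
  comes for free: the mean of the crossing time of length \<open>n\<close> is at most \<open>n rate\<close>, and a random
  variable that is rarely much below its mean cannot often be much above it. Finally a path that
  crosses a slab may be completed to a path between the two end points on the axis at the expense of
  moving inside the first and the last column, and this cost is negligible after division by \<open>n\<close>.
  Therefore \<open>time_constant_eq_rate\<close> holds, with \<open>rate\<close> possibly infinite.

  It remains to see that the limit for the wide tube is finite, which matters when the one for the
  narrow tube is infinite. If the passage times are integrable, one walks straight ahead. Otherwise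
  the wide tube has width at least \<open>4\<close>, and there two adjacent interior points are joined by \<open>2 d\<close>
  edge-disjoint paths of bounded length; the fastest of them has a finite mean as soon as the
  minimum of \<open>2 d\<close> independent passage times has one (\<open>rate_finite_min\<close>).

  Almost all inequalities between passage times are obtained by the potential method
  (\<open>pdist_potential\<close>): if a function on the vertices drops along each edge by at most the weight of
  the edge, then its drop from \<open>u\<close> to \<open>v\<close> is at most the passage time. This replaces the cutting and
  gluing of paths.
\<close>

section \<open>Passage times for extended non-negative weights\<close>

text \<open>
  In \<open>ennreal\<close> the infimum is meaningful without any lower bound, and weights may be set to zero or
  rescaled freely. \<open>ennreal_passage_time\<close> makes the link with \<open>passage_time\<close>.
\<close>

definition pdist :: "nat \<Rightarrow> nat \<Rightarrow> (vertex set \<Rightarrow> ennreal) \<Rightarrow> vertex \<Rightarrow> vertex \<Rightarrow> ennreal" where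
  "pdist d K w u v = (INF p\<in>tube_paths d K u v. \<Sum>e\<leftarrow>path_edges p. w e)"

lemma path_edges_simps [simp]:
  "path_edges [x] = []"
  "path_edges (x # y # p) = {x, y} # path_edges (y # p)"
  by (simp_all add: path_edges_def)

lemma ennreal_le_add_INF:
  fixes x c :: ennreal
  assumes "\<And>i. i \<in> I \<Longrightarrow> x \<le> c + f i"
  shows "x \<le> c + (INF i\<in>I. f i)"
proof (cases "c = \<top>")
  case False
  have "x - c \<le> (INF i\<in>I. f i)"
    using assms False by (intro INF_greatest) (auto simp: ennreal_minus_le_iff)
  then show ?thesis
    using False by (auto simp: ennreal_minus_le_iff)
qed auto

lemma path_potential:
  fixes \<phi> :: "vertex \<Rightarrow> ennreal"
  assumes step: "\<And>x y. x \<in> tube_vertices d K \<Longrightarrow> y \<in> tube_vertices d K \<Longrightarrow> neighbours d x y \<Longrightarrow>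
      \<phi> x \<le> w {x, y} + \<phi> y"
    and "p \<noteq> []" "set p \<subseteq> tube_vertices d K" "successively (neighbours d) p"
  shows "\<phi> (hd p) \<le> (\<Sum>e\<leftarrow>path_edges p. w e) + \<phi> (last p)"
  using assms(2-)
proof (induction p rule: induct_list012)
  case (3 x y zs)
  have "\<phi> x \<le> w {x, y} + \<phi> y"
    using 3 by (intro step) auto
  also have "\<phi> y \<le> (\<Sum>e\<leftarrow>path_edges (y # zs). w e) + \<phi> (last (y # zs))"
    using 3 by auto
  finally show ?case
    by (simp add: add_left_mono add.assoc)
qed auto

text \<open>
  The potential \<open>\<phi>\<close> need not be the distance to a point; this is the weak half of the duality
  between shortest paths and potentials, and most lower bounds on passage times below are instances
  of it.
\<close>

lemma pdist_potential:
  fixes \<phi> :: "vertex \<Rightarrow> ennreal"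
  assumes "\<And>x y. x \<in> tube_vertices d K \<Longrightarrow> y \<in> tube_vertices d K \<Longrightarrow> neighbours d x y \<Longrightarrow>
      \<phi> x \<le> w {x, y} + \<phi> y"
  shows "\<phi> u \<le> pdist d K w u v + \<phi> v"
  unfolding pdist_def
proof (subst add.commute, rule ennreal_le_add_INF)
  fix p assume "p \<in> tube_paths d K u v"
  then show "\<phi> u \<le> \<phi> v + (\<Sum>e\<leftarrow>path_edges p. w e)"
    using path_potential[of d K \<phi> w p] assms by (auto simp: tube_paths_def add.commute)
qed

lemma pdist_refl [simp]: "u \<in> tube_vertices d K \<Longrightarrow> pdist d K w u u = 0"
  unfolding pdist_def
  by (rule antisym, rule INF_lower2[of "[u]"]) (auto simp: tube_paths_def)

lemma pdist_step:
  assumes "x \<in> tube_vertices d K" "y \<in> tube_vertices d K" "neighbours d x y"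
  shows "pdist d K w x z \<le> w {x, y} + pdist d K w y z"
  unfolding pdist_def[of _ _ _ y]
proof (rule ennreal_le_add_INF)
  fix p assume p: "p \<in> tube_paths d K y z"
  then obtain q where q: "p = y # q"
    by (cases p) (auto simp: tube_paths_def)
  show "pdist d K w x z \<le> w {x, y} + (\<Sum>e\<leftarrow>path_edges p. w e)"
    unfolding pdist_def
    by (rule INF_lower2[of "x # p"]) (use p assms q in \<open>auto simp: tube_paths_def\<close>)
qed

lemma pdist_triangle: "pdist d K w x z \<le> pdist d K w x y + pdist d K w y z"
  by (rule pdist_potential) (rule pdist_step)

lemma pdist_edge:
  assumes "x \<in> tube_vertices d K" "y \<in> tube_vertices d K" "neighbours d x y"
  shows "pdist d K w x y \<le> w {x, y}"
  using pdist_step[OF assms, of w y] assms by simp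

lemma pdist_mono:
  assumes "\<And>e. e \<in> tube_edges d K \<Longrightarrow> w e \<le> w' e"
  shows "pdist d K w u v \<le> pdist d K w' u v"
proof (cases "v \<in> tube_vertices d K")
  case True
  have "pdist d K w u v \<le> pdist d K w' u v + pdist d K w v v"
  proof (rule pdist_potential[where \<phi> = "\<lambda>x. pdist d K w x v"])
    fix x y assume *: "x \<in> tube_vertices d K" "y \<in> tube_vertices d K" "neighbours d x y"
    have "w {x, y} \<le> w' {x, y}"
      using * by (intro assms) (auto simp: tube_edges_def)
    then show "pdist d K w x v \<le> w' {x, y} + pdist d K w y v"
      using pdist_step[OF *, of w v] by (meson add_right_mono order_trans)
  qed
  then show ?thesis using True by simp
next
  case False
  then have "tube_paths d K u v = {}"
    using last_in_set by (fastforce simp: tube_paths_def)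
  then show ?thesis by (simp add: pdist_def)
qed

lemma tube_vertices_mono: "K \<le> K' \<Longrightarrow> tube_vertices d K \<subseteq> tube_vertices d K'"
  unfolding tube_vertices_def by force

lemma pdist_tube_mono: "K \<le> K' \<Longrightarrow> pdist d K' w u v \<le> pdist d K w u v"
  unfolding pdist_def using tube_vertices_mono[of K K' d]
  by (intro INF_superset_mono) (auto simp: tube_paths_def)

lemma sum_pdist_le:
  fixes w :: "'i \<Rightarrow> vertex set \<Rightarrow> ennreal"
  assumes "finite I" and le: "\<And>e. (\<Sum>i\<in>I. w i e) \<le> w' e"
  shows "(\<Sum>i\<in>I. pdist d K (w i) u v) \<le> pdist d K w' u v"
  unfolding pdist_def[of _ _ w']
proof (rule INF_greatest)
  fix p assume p: "p \<in> tube_paths d K u v"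
  have "(\<Sum>i\<in>I. pdist d K (w i) u v) \<le> (\<Sum>i\<in>I. \<Sum>e\<leftarrow>path_edges p. w i e)"
    unfolding pdist_def by (intro sum_mono INF_lower p)
  also have "\<dots> = (\<Sum>e\<leftarrow>path_edges p. \<Sum>i\<in>I. w i e)"
  proof -
    have "(\<Sum>i\<in>I. \<Sum>e\<leftarrow>es. w i e) = (\<Sum>e\<leftarrow>es. \<Sum>i\<in>I. w i e)" for es
      by (induction es) (auto simp: sum.distrib)
    then show ?thesis .
  qed
  also have "\<dots> \<le> (\<Sum>e\<leftarrow>path_edges p. w' e)"
    by (intro sum_list_mono le)
  finally show "(\<Sum>i\<in>I. pdist d K (w i) u v) \<le> (\<Sum>e\<leftarrow>path_edges p. w' e)" .
qed

section \<open>Columns and translations of the tube\<close>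

definition axis_vertex :: "int \<Rightarrow> vertex" where
  "axis_vertex s = (\<lambda>i. if i = 0 then s else 0)"

definition tube_column :: "nat \<Rightarrow> nat \<Rightarrow> int \<Rightarrow> vertex set" where
  "tube_column d K s = {x \<in> tube_vertices d K. x 0 = s}"

lemma tube_columnD: "x \<in> tube_column d K s \<Longrightarrow> x \<in> tube_vertices d K" "x \<in> tube_column d K s \<Longrightarrow> x 0 = s"
  by (auto simp: tube_column_def)

lemma axis_0 [simp]: "axis_vertex s 0 = s"
  by (simp add: axis_vertex_def)

lemma axis_in_tube [simp]: "d > 0 \<Longrightarrow> K > 0 \<Longrightarrow> axis_vertex s \<in> tube_vertices d K"
  by (auto simp: axis_vertex_def tube_vertices_def)

lemma axis_in_column [simp]: "d > 0 \<Longrightarrow> K > 0 \<Longrightarrow> axis_vertex s \<in> tube_column d K s"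
  by (simp add: tube_column_def)

lemma neighbours_sym: "neighbours d x y \<longleftrightarrow> neighbours d y x"
  by (simp add: neighbours_def abs_minus_commute)

lemma neighbours_upd:
  assumes "i < d" "\<bar>x i - z\<bar> = 1"
  shows "neighbours d x (x(i := z))"
proof -
  have "(\<Sum>j<d. \<bar>x j - (x(i := z)) j\<bar>) = (\<Sum>j<d. if j = i then 1 else 0)"
    using assms by (intro sum.cong) auto
  then show ?thesis
    using assms by (simp add: neighbours_def)
qed

lemma neighbours_dist_le:
  assumes "neighbours d x y" "i < d"
  shows "\<bar>x i - y i\<bar> \<le> 1"
  using assms member_le_sum[of i "{..<d}" "\<lambda>i. \<bar>x i - y i\<bar>"] by (auto simp: neighbours_def)

lemma tube_coordinate: "x \<in> tube_vertices d K \<Longrightarrow> 0 < i \<Longrightarrow> i < d \<Longrightarrow> 0 \<le> x i \<and> x i < int K"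
  by (simp add: tube_vertices_def)

lemma finite_tube_slab: "finite {x \<in> tube_vertices d K. a \<le> x 0 \<and> x 0 \<le> b}"
proof -
  have "inj_on (\<lambda>x. map x [0..<d]) (tube_vertices d K)"
  proof (rule inj_onI)
    fix x y assume *: "x \<in> tube_vertices d K" "y \<in> tube_vertices d K" "map x [0..<d] = map y [0..<d]"
    show "x = y"
    proof
      fix i show "x i = y i"
        using * by (cases "i < d") (auto simp: tube_vertices_def)
    qed
  qed
  then have inj: "inj_on (\<lambda>x. map x [0..<d]) {x \<in> tube_vertices d K. a \<le> x 0 \<and> x 0 \<le> b}"
    by (rule inj_on_subset) auto
  let ?A = "{min a 0..max b (int K)}"
  have "(\<lambda>x. map x [0..<d]) ` {x \<in> tube_vertices d K. a \<le> x 0 \<and> x 0 \<le> b}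
      \<subseteq> {xs. set xs \<subseteq> ?A \<and> length xs = d}"
  proof (rule image_subsetI)
    fix x assume x: "x \<in> {x \<in> tube_vertices d K. a \<le> x 0 \<and> x 0 \<le> b}"
    have "x i \<in> ?A" if "i < d" for i
      using x that tube_coordinate[of x d K i] by (cases "i = 0") auto
    then show "map x [0..<d] \<in> {xs. set xs \<subseteq> ?A \<and> length xs = d}"
      by auto
  qed
  then have "finite ((\<lambda>x. map x [0..<d]) ` {x \<in> tube_vertices d K. a \<le> x 0 \<and> x 0 \<le> b})"
    by (rule finite_subset) (auto intro: finite_lists_length_eq)
  then show ?thesis
    using inj by (rule finite_imageD)
qed

lemma finite_tube_column [simp]: "finite (tube_column d K s)"
  by (rule finite_subset[OF _ finite_tube_slab[of d K s s]]) (auto simp: tube_column_def)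

lemma countable_tube_vertices: "countable (tube_vertices d K)"
proof -
  have "tube_vertices d K \<subseteq> (\<Union>s. tube_column d K s)"
    by (auto simp: tube_column_def)
  then show ?thesis
    by (rule countable_subset) (intro countable_UN countable_finite finite_tube_column countableI_type)
qed

lemma countable_tube_paths: "countable (tube_paths d K u v)"
  by (rule countable_subset[OF _ countable_lists[OF countable_tube_vertices[of d K]]])
     (auto simp: tube_paths_def)

definition translate :: "int \<Rightarrow> vertex \<Rightarrow> vertex" where
  "translate s x = x(0 := x 0 + s)"

lemma translate_0 [simp]: "translate s x 0 = x 0 + s"
  by (simp add: translate_def)

lemma translate_translate [simp]: "translate s (translate t x) = translate (s + t) x"
  by (auto simp: translate_def)

lemma translate_zero [simp]: "translate 0 x = x"
  by (auto simp: translate_def)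

lemma translate_axis [simp]: "translate s (axis_vertex t) = axis_vertex (t + s)"
  by (auto simp: translate_def axis_vertex_def)

lemma translate_in_tube [simp]:
  "d > 0 \<Longrightarrow> translate s x \<in> tube_vertices d K \<longleftrightarrow> x \<in> tube_vertices d K"
  unfolding tube_vertices_def translate_def by auto

lemma neighbours_shift [simp]: "neighbours d (translate s x) (translate s y) \<longleftrightarrow> neighbours d x y"
proof -
  have "\<bar>translate s x i - translate s y i\<bar> = \<bar>x i - y i\<bar>" for i
    by (simp add: translate_def)
  then show ?thesis by (simp add: neighbours_def)
qed

lemma bij_shift: "bij (translate s)"
  by (rule bij_betw_byWitness[of _ "translate (- s)"]) auto

lemma INF_shift: "(INF x\<in>{x. P (translate s x)}. f (translate s x)) = (INF x\<in>{x. P x}. f x)"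
proof -
  have "translate s ` {x. P (translate s x)} = {x. P x}"
  proof (intro equalityI subsetI)
    fix x assume "x \<in> {x. P x}"
    then show "x \<in> translate s ` {x. P (translate s x)}"
      by (intro image_eqI[of _ _ "translate (- s) x"]) auto
  qed auto
  then show ?thesis by (metis image_image)
qed

definition shift_weight :: "int \<Rightarrow> (vertex set \<Rightarrow> 'a) \<Rightarrow> vertex set \<Rightarrow> 'a" where
  "shift_weight s w e = w (translate s ` e)"

lemma shift_weight_shift_weight [simp]:
  "shift_weight s (shift_weight t w) = shift_weight (s + t) w"
  by (rule ext) (simp add: shift_weight_def image_image add.commute)

lemma shift_weight_zero [simp]: "shift_weight 0 w = w"
  by (rule ext) (simp add: shift_weight_def)

lemma pdist_shift:
  assumes "d > 0"
  shows "pdist d K (shift_weight s w) u v = pdist d K w (translate s u) (translate s v)"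
proof (cases "v \<in> tube_vertices d K")
  case True
  have *: "pdist d K w (translate s u) (translate s v) \<le> pdist d K (shift_weight s w) u v"
    if "v \<in> tube_vertices d K" for s w u v
  proof -
    have "pdist d K w (translate s u) (translate s v) \<le>
        pdist d K (shift_weight s w) u v + pdist d K w (translate s v) (translate s v)"
    proof (rule pdist_potential[where \<phi> = "\<lambda>x. pdist d K w (translate s x) (translate s v)"])
      fix x y assume "x \<in> tube_vertices d K" "y \<in> tube_vertices d K" "neighbours d x y"
      then show "pdist d K w (translate s x) (translate s v)
          \<le> shift_weight s w {x, y} + pdist d K w (translate s y) (translate s v)"
        using pdist_step[of "translate s x" d K "translate s y" w "translate s v"] assms
        by (simp add: shift_weight_def)
    qed
    then show ?thesis using that assms by simp
  qed
  show ?thesis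
    using *[of v w s u] *[of "translate s v" "shift_weight s w" "- s" "translate s u"] True assms by simp
next
  case False
  have empty: "tube_paths d K u v = {}" if "v \<notin> tube_vertices d K" for u v
    using that last_in_set by (fastforce simp: tube_paths_def)
  have "tube_paths d K u v = {}" "tube_paths d K (translate s u) (translate s v) = {}"
    using False assms by (auto intro!: empty)
  then show ?thesis by (simp add: pdist_def)
qed

text \<open>
  A path visits every column between its end points. The potential is the remaining passage time,
  computed on the left of column \<open>j\<close> subject to the constraint that this column is visited.
\<close>

lemma pdist_passthrough:
  assumes "d > 0" "u \<in> tube_vertices d K" "t \<in> tube_vertices d K" "u 0 \<le> j" "j \<le> t 0"
  shows "(INF v\<in>tube_column d K j. pdist d K w u v + pdist d K w v t) \<le> pdist d K w u t"
proof -
  let ?V = "tube_vertices d K"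
  define D where "D x = (INF v\<in>tube_column d K j. pdist d K w x v + pdist d K w v t)" for x
  define \<phi> where "\<phi> x = (if x 0 \<le> j then D x else pdist d K w x t)" for x
  have D_ge: "pdist d K w x t \<le> D x" for x
    unfolding D_def by (intro INF_greatest pdist_triangle)
  have D_le: "D x \<le> pdist d K w x t" if "x \<in> tube_column d K j" for x
    unfolding D_def by (rule INF_lower2[OF that]) (use that in \<open>auto simp: tube_column_def\<close>)
  have "\<phi> u \<le> pdist d K w u t + \<phi> t"
  proof (rule pdist_potential)
    fix x y assume xy: "x \<in> ?V" "y \<in> ?V" "neighbours d x y"
    have step: "pdist d K w x v \<le> w {x, y} + pdist d K w y v" for v
      by (rule pdist_step[OF xy])
    have "D x \<le> w {x, y} + D y"
      unfolding D_def[of y]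
    proof (rule ennreal_le_add_INF)
      fix v assume v: "v \<in> tube_column d K j"
      have "D x \<le> pdist d K w x v + pdist d K w v t"
        unfolding D_def by (rule INF_lower[OF v])
      also have "\<dots> \<le> w {x, y} + pdist d K w y v + pdist d K w v t"
        by (intro add_right_mono step)
      finally show "D x \<le> w {x, y} + (pdist d K w y v + pdist d K w v t)"
        by (simp add: add.assoc)
    qed
    moreover have "D x \<le> w {x, y} + pdist d K w y t" if "x 0 \<le> j" "\<not> y 0 \<le> j"
    proof -
      have "x \<in> tube_column d K j"
        using that neighbours_dist_le[OF xy(3), of 0] assms xy by (auto simp: tube_column_def)
      then show ?thesis
        using D_le[of x] step[of t] by (meson order_trans)
    qed
    moreover have "pdist d K w x t \<le> w {x, y} + D y"
      using step[of t] D_ge[of y] by (meson add_left_mono order_trans)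
    ultimately show "\<phi> x \<le> w {x, y} + \<phi> y"
      using step[of t] by (auto simp: \<phi>_def)
  qed
  moreover have "\<phi> t = 0"
    using D_le[of t] assms by (auto simp: \<phi>_def tube_column_def)
  ultimately show ?thesis
    using assms by (simp add: \<phi>_def D_def)
qed

text \<open>
  Decreasing one lateral coordinate at a time leads from any vertex of a column to the axis within
  the column, in at most \<open>d K\<close> steps.
\<close>

lemma pdist_column_le:
  assumes "d > 0" "x \<in> tube_vertices d K"
    and B: "\<And>y z. y \<in> tube_column d K (x 0) \<Longrightarrow> z \<in> tube_column d K (x 0) \<Longrightarrow> neighbours d y z \<Longrightarrow> w {y, z} \<le> B"
  shows "pdist d K w x (axis_vertex (x 0)) \<le> of_nat (d * K) * B"
    and "pdist d K w (axis_vertex (x 0)) x \<le> of_nat (d * K) * B"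
proof -
  let ?h = "\<lambda>x. \<Sum>i\<in>{1..<d}. nat (x i)"
  define s where "s = x 0"
  have "pdist d K w y (axis_vertex s) \<le> of_nat (?h y) * B \<and> pdist d K w (axis_vertex s) y \<le> of_nat (?h y) * B"
    if "y \<in> tube_column d K s" for y
    using that
  proof (induction "?h y" arbitrary: y rule: less_induct)
    case less
    note y = tube_columnD[OF less.prems]
    show ?case
    proof (cases "\<forall>i\<in>{1..<d}. y i = 0")
      case True
      have "y i = axis_vertex s i" for i
        using True y by (cases "i < d") (auto simp: axis_vertex_def tube_vertices_def)
      then have "y = axis_vertex s" by auto
      then show ?thesis using y by simp
    next
      case False
      then obtain i where i: "i \<in> {1..<d}" "y i \<noteq> 0" by auto
      then have yi: "0 < y i" "y i < int K"
        using y(1) by (force simp: tube_vertices_def)+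
      define z where "z = y(i := y i - 1)"
      have "0 \<le> y i - 1" "y i - 1 < int K"
        using yi by auto
      then have z: "z \<in> tube_column d K s"
        using i y by (simp add: z_def tube_column_def tube_vertices_def)
      have nb: "neighbours d y z"
        unfolding z_def using i by (intro neighbours_upd) auto
      have wB: "w {y, z} \<le> B" "w {z, y} \<le> B"
        using B[of y z] B[of z y] less.prems z nb neighbours_sym[of d y z] by (auto simp: s_def)
      have h: "?h y = Suc (?h z)"
      proof -
        have "?h y = nat (y i) + (\<Sum>j\<in>{1..<d} - {i}. nat (y j))"
          using i by (simp add: sum.remove)
        also have "(\<Sum>j\<in>{1..<d} - {i}. nat (y j)) = (\<Sum>j\<in>{1..<d} - {i}. nat (z j))"
          by (intro sum.cong) (auto simp: z_def)
        also have "nat (y i) = Suc (nat (z i))"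
          using yi by (simp add: z_def)
        also have "Suc (nat (z i)) + (\<Sum>j\<in>{1..<d} - {i}. nat (z j)) = Suc (?h z)"
          using i by (simp add: sum.remove)
        finally show ?thesis .
      qed
      have IH: "pdist d K w z (axis_vertex s) \<le> of_nat (?h z) * B" "pdist d K w (axis_vertex s) z \<le> of_nat (?h z) * B"
        using less.hyps[of z] h z by auto
      have "pdist d K w y (axis_vertex s) \<le> B + of_nat (?h z) * B"
        using pdist_step[of y d K z w "axis_vertex s"] nb y tube_columnD[OF z] wB IH(1)
        by (meson add_mono order_trans)
      moreover have "pdist d K w (axis_vertex s) y \<le> of_nat (?h z) * B + B"
        using pdist_triangle[of d K w "axis_vertex s" y z] pdist_edge[of z d K y w] nb y tube_columnD[OF z] wB IH(2)
          neighbours_sym[of d y z]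
        by (meson add_mono order_trans)
      ultimately show ?thesis
        unfolding h by (simp add: distrib_right add.commute)
    qed
  qed
  moreover have "x \<in> tube_column d K s"
    using assms by (simp add: tube_column_def s_def)
  moreover have "of_nat (?h x) * B \<le> of_nat (d * K) * B"
  proof -
    have "?h x \<le> (\<Sum>i\<in>{1..<d}. K)"
    proof (rule sum_mono)
      fix i assume "i \<in> {1..<d}"
      then show "nat (x i) \<le> K"
        using tube_coordinate[OF assms(2), of i] by auto
    qed
    also have "\<dots> \<le> d * K" by (simp add: diff_mult_distrib)
    finally show ?thesis by (intro mult_right_mono of_nat_mono) auto
  qed
  ultimately show "pdist d K w x (axis_vertex (x 0)) \<le> of_nat (d * K) * B"
    "pdist d K w (axis_vertex (x 0)) x \<le> of_nat (d * K) * B"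
    unfolding s_def by (meson order_trans)+
qed

lemma pdist_row_le:
  assumes "d > 0" "x \<in> tube_vertices d K"
    and B: "\<And>j. j < n \<Longrightarrow> w {translate (int j) x, translate (int (Suc j)) x} \<le> B"
  shows "pdist d K w x (translate (int n) x) \<le> of_nat n * B"
  using B
proof (induction n)
  case (Suc n)
  let ?y = "translate (int n) x" and ?z = "translate (int (Suc n)) x"
  have "neighbours d ?y ?z"
    using neighbours_upd[of 0 d ?y "?z 0"] assms by (auto simp: translate_def)
  then have "pdist d K w ?y ?z \<le> B"
    using pdist_edge[of ?y d K ?z w] assms Suc.prems[of n] by (auto intro: order_trans)
  then have "pdist d K w x ?z \<le> of_nat n * B + B"
    using Suc pdist_triangle[of d K w x ?z ?y] by (meson add_mono less_Suc_eq order_trans)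
  then show ?case by (simp add: distrib_right add.commute)
qed (use assms in simp)

text \<open>
  Each of the \<open>b - a\<close> gaps between neighbouring columns has to be crossed by a lengthwise edge.
\<close>

lemma pdist_ge_columns:
  assumes "d > 0" "u \<in> tube_column d K a" "v \<in> tube_column d K b" "a \<le> b"
    and \<beta>: "\<And>x y. x \<in> tube_vertices d K \<Longrightarrow> y \<in> tube_vertices d K \<Longrightarrow> neighbours d x y \<Longrightarrow>
      a \<le> x 0 \<Longrightarrow> y 0 = x 0 + 1 \<Longrightarrow> y 0 \<le> b \<Longrightarrow> \<beta> \<le> w {x, y}"
  shows "of_nat (nat (b - a)) * \<beta> \<le> pdist d K w u v"
proof -
  define \<phi> :: "vertex \<Rightarrow> ennreal" where "\<phi> x = of_nat (nat (b - max a (x 0))) * \<beta>" for x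
  have "\<phi> u \<le> pdist d K w u v + \<phi> v"
  proof (rule pdist_potential)
    fix x y assume xy: "x \<in> tube_vertices d K" "y \<in> tube_vertices d K" "neighbours d x y"
    show "\<phi> x \<le> w {x, y} + \<phi> y"
    proof (cases "a \<le> x 0 \<and> y 0 = x 0 + 1 \<and> y 0 \<le> b")
      case True
      then have "nat (b - max a (x 0)) = Suc (nat (b - max a (y 0)))"
        by auto
      then show ?thesis
        using \<beta>[OF xy] True by (simp add: \<phi>_def distrib_right)
    next
      case False
      then have "nat (b - max a (x 0)) \<le> nat (b - max a (y 0))"
        using neighbours_dist_le[OF xy(3), of 0] \<open>d > 0\<close> by auto
      then have "\<phi> x \<le> \<phi> y"
        unfolding \<phi>_def by (intro mult_right_mono) auto
      then show ?thesis by (simp add: add_increasing)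
    qed
  qed
  then show ?thesis
    using assms by (simp add: \<phi>_def tube_column_def)
qed

section \<open>Crossing times of slabs\<close>

text \<open>
  The edges inside the last column are left out, so that consecutive slabs have no edge in common.
\<close>

definition slab :: "int \<Rightarrow> int \<Rightarrow> vertex set set" where
  "slab a b = {e. (\<forall>x\<in>e. a \<le> x 0 \<and> x 0 \<le> b) \<and> (\<exists>x\<in>e. x 0 < b)}"

text \<open>
  Paths may start anywhere on the left and end anywhere on the right of the slab, and only the time
  spent on edges of the slab counts. With this definition every path that runs past several slabs is
  a competitor in each of them, hence superadditivity needs no decomposition of paths.
\<close>

definition cross :: "nat \<Rightarrow> nat \<Rightarrow> int \<Rightarrow> int \<Rightarrow> (vertex set \<Rightarrow> ennreal) \<Rightarrow> ennreal" where
  "cross d K a b w =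
     (INF u\<in>{u. u \<in> tube_vertices d K \<and> u 0 \<le> a}. INF v\<in>{v. v \<in> tube_vertices d K \<and> b \<le> v 0}.
        pdist d K (\<lambda>e. w e * indicator (slab a b) e) u v)"

lemma cross_cong:
  assumes "\<And>e. e \<in> slab a b \<Longrightarrow> w e = w' e"
  shows "cross d K a b w = cross d K a b w'"
proof -
  have "(\<lambda>e. w e * indicator (slab a b) e) = (\<lambda>e. w' e * indicator (slab a b) e)"
    using assms by (auto simp: indicator_def)
  then show ?thesis by (simp add: cross_def)
qed

lemma slab_shift: "translate s ` e \<in> slab (a + s) (b + s) \<longleftrightarrow> e \<in> slab a b"
  by (auto simp: slab_def)

lemma cross_shift:
  assumes "d > 0"
  shows "cross d K a b (shift_weight s w) = cross d K (a + s) (b + s) w"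
proof -
  have w: "(\<lambda>e. shift_weight s w e * indicator (slab a b) e) =
      shift_weight s (\<lambda>e. w e * indicator (slab (a + s) (b + s)) e)"
    by (auto simp: shift_weight_def indicator_def slab_shift)
  define F where "F = pdist d K (\<lambda>e. w e * indicator (slab (a + s) (b + s)) e)"
  have inner: "(INF v\<in>{v. v \<in> tube_vertices d K \<and> b \<le> v 0}. F u (translate s v)) =
      (INF v\<in>{v. v \<in> tube_vertices d K \<and> b + s \<le> v 0}. F u v)" for u
    using INF_shift[where s = s and P = "\<lambda>v. v \<in> tube_vertices d K \<and> b + s \<le> v 0" and f = "F u"] assms
    by simp
  have outer: "(INF u\<in>{u. u \<in> tube_vertices d K \<and> u 0 \<le> a}. G (translate s u)) =
      (INF u\<in>{u. u \<in> tube_vertices d K \<and> u 0 \<le> a + s}. G u)" for G :: "vertex \<Rightarrow> ennreal"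
    using INF_shift[where s = s and P = "\<lambda>u. u \<in> tube_vertices d K \<and> u 0 \<le> a + s" and f = G] assms
    by simp
  show ?thesis
    unfolding cross_def w pdist_shift[OF assms] F_def[symmetric] inner
    by (rule outer)
qed

lemma cross_le_pdist:
  assumes "u \<in> tube_vertices d K" "u 0 \<le> a" "v \<in> tube_vertices d K" "b \<le> v 0"
  shows "cross d K a b w \<le> pdist d K w u v"
proof -
  have "cross d K a b w \<le> pdist d K (\<lambda>e. w e * indicator (slab a b) e) u v"
    unfolding cross_def using assms by (intro INF_lower2[of u] INF_lower2[of v]) auto
  also have "\<dots> \<le> pdist d K w u v"
    by (rule pdist_mono) (auto simp: indicator_def)
  finally show ?thesis .
qed

lemma disjoint_slabs: "disjoint_family_on (\<lambda>i. slab (int (k * i)) (int (k * Suc i))) L"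
proof -
  have no: False if "i < j" "e \<in> slab (int (k * i)) (int (k * Suc i))"
    "e \<in> slab (int (k * j)) (int (k * Suc j))" for i j e
  proof -
    from that obtain x where "x \<in> e" "x 0 < int (k * Suc i)" "int (k * j) \<le> x 0"
      by (auto simp: slab_def)
    moreover have "k * Suc i \<le> k * j"
      using that by (intro mult_left_mono) auto
    ultimately show False by linarith
  qed
  show ?thesis
    unfolding disjoint_family_on_def using no by (metis disjoint_iff linorder_neqE_nat)
qed

lemma sum_slab_le:
  fixes w :: "vertex set \<Rightarrow> ennreal"
  assumes "k * m \<le> n"
  shows "(\<Sum>i<m. w e * indicator (slab (int (k * i)) (int (k * Suc i))) e)
    \<le> w e * indicator (slab 0 (int n)) e"
proof (cases "\<exists>j<m. e \<in> slab (int (k * j)) (int (k * Suc j))")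
  case True
  then obtain j where j: "j < m" "e \<in> slab (int (k * j)) (int (k * Suc j))" by auto
  have other: "e \<notin> slab (int (k * i)) (int (k * Suc i))" if "i \<noteq> j" for i
    using disjoint_slabs[of k UNIV] j(2) that unfolding disjoint_family_on_def by blast
  have "(\<Sum>i<m. w e * indicator (slab (int (k * i)) (int (k * Suc i))) e) =
      (\<Sum>i\<in>{j}. w e * indicator (slab (int (k * i)) (int (k * Suc i))) e)"
    using j other by (intro sum.mono_neutral_right) (auto simp: indicator_def)
  moreover have "e \<in> slab 0 (int n)"
  proof -
    have "k * Suc j \<le> k * m" using j by (intro mult_left_mono) auto
    then have "int (k * Suc j) \<le> int n" using assms by linarith
    moreover have "0 \<le> int (k * j)" by simp
    ultimately show ?thesis
      using j(2) unfolding slab_def mem_Collect_eq by (meson order_trans less_le_trans)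
  qed
  ultimately show ?thesis using j(2) by (simp only:) (simp add: indicator_def)
next
  case False
  then have "(\<Sum>i<m. w e * indicator (slab (int (k * i)) (int (k * Suc i))) e) = 0"
    by (intro sum.neutral) (auto simp: indicator_def)
  then show ?thesis by (simp only: zero_le)
qed

text \<open>
  Superadditivity: the blocks are edge-disjoint parts of the large slab, and a path that crosses the
  large slab crosses each block.
\<close>

lemma sum_cross_le_cross:
  assumes "k * m \<le> n"
  shows "(\<Sum>i<m. cross d K (int (k * i)) (int (k * Suc i)) w) \<le> cross d K 0 (int n) w"
  unfolding cross_def[of _ _ 0]
proof (intro INF_greatest)
  fix u v assume uv: "u \<in> {u. u \<in> tube_vertices d K \<and> u 0 \<le> 0}"
    "v \<in> {v. v \<in> tube_vertices d K \<and> int n \<le> v 0}"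
  have "(\<Sum>i<m. cross d K (int (k * i)) (int (k * Suc i)) w)
      \<le> (\<Sum>i<m. pdist d K (\<lambda>e. w e * indicator (slab (int (k * i)) (int (k * Suc i))) e) u v)"
  proof (rule sum_mono)
    fix i assume "i \<in> {..<m}"
    then have "k * Suc i \<le> k * m" by (intro mult_left_mono) auto
    then have "int (k * Suc i) \<le> int n" using assms by linarith
    then have "int (k * Suc i) \<le> v 0" "u 0 \<le> int (k * i)"
      using uv of_nat_0_le_iff[of "k * i", where 'a = int] unfolding mem_Collect_eq by linarith+
    then show "cross d K (int (k * i)) (int (k * Suc i)) w
        \<le> pdist d K (\<lambda>e. w e * indicator (slab (int (k * i)) (int (k * Suc i))) e) u v"
      unfolding cross_def using uv by (intro INF_lower2[of u] INF_lower2[of v]) auto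
  qed
  also have "\<dots> \<le> pdist d K (\<lambda>e. w e * indicator (slab 0 (int n)) e) u v"
    by (intro sum_pdist_le sum_slab_le[OF assms]) auto
  finally show "(\<Sum>i<m. cross d K (int (k * i)) (int (k * Suc i)) w) \<le> \<dots>" .
qed

text \<open>
  A crude bound for the time needed to get from the axis to any vertex of a column and back, which
  suffices as it is finite and has the same law in each column.
\<close>

definition column_cost :: "nat \<Rightarrow> nat \<Rightarrow> int \<Rightarrow> (vertex set \<Rightarrow> ennreal) \<Rightarrow> ennreal" where
  "column_cost d K s w = (\<Sum>x\<in>tube_column d K s. pdist d K w (axis_vertex s) x + pdist d K w x (axis_vertex s))"

lemma column_cost_ge:
  assumes "x \<in> tube_column d K s"
  shows "pdist d K w (axis_vertex s) x \<le> column_cost d K s w" "pdist d K w x (axis_vertex s) \<le> column_cost d K s w"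
proof -
  have "pdist d K w (axis_vertex s) x + pdist d K w x (axis_vertex s) \<le> column_cost d K s w"
    unfolding column_cost_def using assms by (intro member_le_sum) auto
  then show "pdist d K w (axis_vertex s) x \<le> column_cost d K s w" "pdist d K w x (axis_vertex s) \<le> column_cost d K s w"
    by (meson add_increasing add_increasing2 order_refl order_trans zero_le)+
qed

lemma column_cost_finite:
  assumes "d > 0" "\<And>e. w e < \<top>"
  shows "column_cost d K s w < \<top>"
proof -
  define B where "B = (\<Sum>(y, z)\<in>tube_column d K s \<times> tube_column d K s. w {y, z})"
  have B: "B < \<top>"
    unfolding B_def using assms(2) by (auto simp: less_top)
  have wB: "w {y, z} \<le> B" if "y \<in> tube_column d K s" "z \<in> tube_column d K s" for y z
    unfolding B_def using that member_le_sum[of "(y, z)" "tube_column d K s \<times> tube_column d K s" "\<lambda>(y, z). w {y, z}"]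
    by auto
  have "pdist d K w x (axis_vertex s) < \<top> \<and> pdist d K w (axis_vertex s) x < \<top>" if "x \<in> tube_column d K s" for x
  proof -
    have "pdist d K w x (axis_vertex s) \<le> of_nat (d * K) * B" "pdist d K w (axis_vertex s) x \<le> of_nat (d * K) * B"
      using pdist_column_le[of d x K w B] that wB assms(1) by (auto simp: tube_column_def)
    moreover have "of_nat (d * K) * B < \<top>"
      using B by (simp add: ennreal_mult_less_top of_nat_less_top)
    ultimately show ?thesis by (meson le_less_trans)
  qed
  then show ?thesis
    unfolding column_cost_def by (auto simp: less_top)
qed

lemma column_shift: "d > 0 \<Longrightarrow> bij_betw (translate s) (tube_column d K t) (tube_column d K (t + s))"
  by (rule bij_betw_byWitness[of _ "translate (- s)"]) (auto simp: tube_column_def)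

lemma column_cost_shift:
  assumes "d > 0"
  shows "column_cost d K t (shift_weight s w) = column_cost d K (t + s) w"
  unfolding column_cost_def pdist_shift[OF assms] translate_axis
  by (rule sum.reindex_bij_betw[OF column_shift[OF assms]])

text \<open>
  A path crossing the slab may leave it and reenter it at another vertex of its first column. With
  \<open>D x\<close> the passage time from \<open>x\<close> to the last column, such excursions are accounted for by the
  potential that equals the minimum \<open>D0\<close> of \<open>D\<close> over the first column to the left of the slab,
  \<open>min D0 (D x)\<close> inside it and zero to its right.
\<close>

lemma pdist_le_cross:
  assumes "d > 0" "K > 0" "a < b"
  shows "pdist d K w (axis_vertex a) (axis_vertex b) \<le> column_cost d K a w + column_cost d K b w + cross d K a b w"
proof -
  let ?V = "tube_vertices d K"
  define D where "D x = (INF v\<in>tube_column d K b. pdist d K w x v)" for x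
  define D0 where "D0 = (INF x\<in>tube_column d K a. D x)"
  define \<phi> where "\<phi> x = (if x 0 \<le> a then D0 else if x 0 < b then min D0 (D x) else 0)" for x
  let ?w = "\<lambda>e. w e * indicator (slab a b) e"
  have step: "D x \<le> w {x, y} + D y" if xy: "x \<in> ?V" "y \<in> ?V" "neighbours d x y" for x y
    unfolding D_def[of y]
  proof (rule ennreal_le_add_INF)
    fix v assume "v \<in> tube_column d K b"
    then have "D x \<le> pdist d K w x v" unfolding D_def by (rule INF_lower)
    then show "D x \<le> w {x, y} + pdist d K w y v"
      using pdist_step[OF xy, of w v] by (rule order_trans)
  qed
  have D_b: "D y = 0" if "y \<in> tube_column d K b" for y
    using INF_lower[OF that, of "\<lambda>v. pdist d K w y v"] that by (auto simp: D_def tube_column_def)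
  have \<phi>_step: "\<phi> x \<le> ?w {x, y} + \<phi> y" if xy: "x \<in> ?V" "y \<in> ?V" "neighbours d x y" for x y
  proof -
    consider "b \<le> x 0" | "x 0 \<le> a" "y 0 \<le> a" | "x 0 = a" "y 0 = a + 1" | "a < x 0" "x 0 < b" "y 0 = a"
      | "a < x 0" "x 0 < b" "a < y 0" "y 0 \<le> b"
      using neighbours_dist_le[OF xy(3), of 0] \<open>d > 0\<close> \<open>a < b\<close> by fastforce
    then show ?thesis
    proof cases
      case 1
      then show ?thesis using \<open>a < b\<close> by (simp add: \<phi>_def)
    next
      case 2
      then show ?thesis by (simp add: \<phi>_def add_increasing)
    next
      case 3
      have "D0 \<le> D x"
        unfolding D0_def using 3 xy by (intro INF_lower) (auto simp: tube_column_def)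
      then have le: "D0 \<le> w {x, y} + D y"
        using step[OF xy] by (rule order_trans)
      moreover have "?w {x, y} = w {x, y}"
        using 3 \<open>a < b\<close> by (simp add: slab_def)
      moreover have "D y = 0" if "y 0 = b" using that D_b[of y] xy by (simp add: tube_column_def)
      ultimately show ?thesis
        using 3 \<open>a < b\<close> by (auto simp: \<phi>_def min_def add_increasing)
    next
      case 4
      then show ?thesis by (simp add: \<phi>_def min.coboundedI1 add_increasing)
    next
      case 5
      have "?w {x, y} = w {x, y}"
        using 5 by (simp add: slab_def)
      moreover have "D y = 0" if "y 0 = b" using that D_b[of y] xy by (simp add: tube_column_def)
      ultimately show ?thesis
        using 5 step[OF xy] by (auto simp: \<phi>_def min_def add_increasing intro: order_trans)
    qed
  qed
  have "D0 \<le> cross d K a b w"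
    unfolding cross_def
  proof (intro INF_greatest)
    fix u v assume "u \<in> {u. u \<in> ?V \<and> u 0 \<le> a}" "v \<in> {v. v \<in> ?V \<and> b \<le> v 0}"
    then show "D0 \<le> pdist d K ?w u v"
      using pdist_potential[of d K \<phi> ?w u v, OF \<phi>_step] \<open>a < b\<close> by (simp add: \<phi>_def)
  qed
  have "pdist d K w (axis_vertex a) (axis_vertex b) \<le> column_cost d K a w + column_cost d K b w + D0"
    unfolding D0_def D_def
  proof (intro ennreal_le_add_INF)
    fix x v assume x: "x \<in> tube_column d K a" and v: "v \<in> tube_column d K b"
    have "pdist d K w (axis_vertex a) (axis_vertex b) \<le>
        pdist d K w (axis_vertex a) x + (pdist d K w x v + pdist d K w v (axis_vertex b))"
      using pdist_triangle[of d K w "axis_vertex a" "axis_vertex b" x] pdist_triangle[of d K w x "axis_vertex b" v]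
      by (meson add_left_mono order_trans)
    also have "\<dots> \<le> column_cost d K a w + (pdist d K w x v + column_cost d K b w)"
      by (intro add_mono column_cost_ge x v order_refl)
    finally show "pdist d K w (axis_vertex a) (axis_vertex b)
        \<le> column_cost d K a w + column_cost d K b w + pdist d K w x v"
      by (simp add: ac_simps)
  qed
  also have "\<dots> \<le> column_cost d K a w + column_cost d K b w + cross d K a b w"
    by (intro add_left_mono \<open>D0 \<le> _\<close>)
  finally show ?thesis .
qed

section \<open>The random environment\<close>

text \<open>
  Negative passage times, which have probability zero, are turned into zero.
\<close>

definition wt :: "(vertex set \<Rightarrow> real) \<Rightarrow> vertex set \<Rightarrow> ennreal" where
  "wt \<tau> e = ennreal (\<tau> e)"

lemma wt_shift_weight: "wt (shift_weight s \<tau>) = shift_weight s (wt \<tau>)"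
  by (auto simp: wt_def shift_weight_def)

lemma measurable_sum_list_ennreal:
  fixes f :: "'i \<Rightarrow> 'a \<Rightarrow> ennreal"
  assumes "\<And>e. f e \<in> borel_measurable M"
  shows "(\<lambda>x. \<Sum>e\<leftarrow>es. f e x) \<in> borel_measurable M"
  using assms by (induction es) auto

lemma measurable_pdist:
  assumes "\<And>e. (\<lambda>x. w x e) \<in> borel_measurable M"
  shows "(\<lambda>x. pdist d K (w x) u v) \<in> borel_measurable M"
  unfolding pdist_def
  by (intro borel_measurable_INF countable_tube_paths measurable_sum_list_ennreal assms)

lemma measurable_cross:
  assumes "\<And>e. (\<lambda>x. w x e) \<in> borel_measurable M"
  shows "(\<lambda>x. cross d K a b (w x)) \<in> borel_measurable M"
proof -
  have "countable {v. v \<in> tube_vertices d K \<and> Q v}" for Q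
    by (rule countable_subset[OF _ countable_tube_vertices[of d K]]) auto
  moreover have "(\<lambda>x. w x e * indicator (slab a b) e) \<in> borel_measurable M" for e
    using assms by (cases "e \<in> slab a b") auto
  ultimately show ?thesis
    unfolding cross_def by (intro borel_measurable_INF measurable_pdist)
qed

lemma measurable_column_cost:
  assumes "\<And>e. (\<lambda>x. w x e) \<in> borel_measurable M"
  shows "(\<lambda>x. column_cost d K s (w x)) \<in> borel_measurable M"
  unfolding column_cost_def
  by (intro borel_measurable_sum borel_measurable_add measurable_pdist assms)

text \<open>
  The environment is indexed by all sets of vertices rather than by the edges of one tube. In this
  way tubes of different widths live on one probability space, and translations permute the index
  set.
\<close>

locale passage_environment =
  fixes d :: nat and P :: "real measure"
  assumes d_pos: "d > 0" and distribution: "real_distribution P" and nonneg: "AE x in P. 0 \<le> x"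
begin

sublocale P: real_distribution P
  by (rule distribution)

abbreviation Om :: "(vertex set \<Rightarrow> real) measure" where
  "Om \<equiv> Pi\<^sub>M UNIV (\<lambda>_. P)"

sublocale Om: prob_space Om
  by (intro prob_space_PiM P.prob_space_axioms)

lemma space_Om [simp]: "space Om = UNIV"
  by (simp add: space_PiM P.space_eq_univ)

lemma events_Collect: "Measurable.pred Om Q \<Longrightarrow> {\<tau>. Q \<tau>} \<in> Om.events"
  by (simp add: pred_def)

lemma measurable_coordinate [measurable]: "(\<lambda>\<tau>. \<tau> e) \<in> borel_measurable Om"
proof -
  have "(\<lambda>\<tau>. \<tau> e) \<in> Om \<rightarrow>\<^sub>M P"
    by (rule measurable_component_singleton) auto
  then show ?thesis by (simp cong: measurable_cong_sets)
qed

lemma measurable_wt [measurable]: "(\<lambda>\<tau>. wt \<tau> e) \<in> borel_measurable Om"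
  unfolding wt_def by measurable

lemmas measurable_pdist_wt [measurable] = measurable_pdist[of wt, OF measurable_wt]
lemmas measurable_cross_wt [measurable] = measurable_cross[of wt, OF measurable_wt]
lemmas measurable_column_cost_wt [measurable] = measurable_column_cost[of wt, OF measurable_wt]

lemma distr_Om_reindex:
  assumes "inj_on f I"
  shows "distr Om (Pi\<^sub>M I (\<lambda>_. P)) (\<lambda>\<tau>. \<lambda>e\<in>I. \<tau> (f e)) = Pi\<^sub>M I (\<lambda>_. P)"
  using distr_PiM_reindex[of UNIV "\<lambda>_. P" f I] assms P.prob_space_axioms by auto

lemma measurable_Om_reindex: "(\<lambda>\<tau>. \<lambda>e\<in>I. \<tau> (f e)) \<in> Om \<rightarrow>\<^sub>M Pi\<^sub>M I (\<lambda>_. P)"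
  by (intro measurable_restrict measurable_component_singleton) auto

lemma inj_shift_edges: "inj (\<lambda>e. translate s ` e)"
  using bij_shift[of s] by (simp add: bij_def inj_image_eq_iff inj_def)

lemma distr_shift: "distr Om Om (shift_weight s) = Om"
proof -
  have "shift_weight s = (\<lambda>\<tau>::vertex set \<Rightarrow> real. \<lambda>e\<in>UNIV. \<tau> (translate s ` e))"
    by (intro ext) (simp add: shift_weight_def)
  then show ?thesis
    using distr_Om_reindex[OF inj_shift_edges, of s] by simp
qed

lemma measurable_shift_weight [measurable]: "shift_weight s \<in> Om \<rightarrow>\<^sub>M Om"
proof -
  have "shift_weight s = (\<lambda>\<tau>::vertex set \<Rightarrow> real. \<lambda>e\<in>UNIV. \<tau> (translate s ` e))"
    by (intro ext) (simp add: shift_weight_def)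
  then show ?thesis
    using measurable_Om_reindex[where I = UNIV and f = "\<lambda>e. translate s ` e"] by simp
qed

lemma distr_shifted:
  assumes "f \<in> borel_measurable Om"
  shows "distr Om borel (\<lambda>\<tau>. f (shift_weight s \<tau>)) = distr Om borel f"
  using distr_distr[OF assms measurable_shift_weight, of s] by (simp add: distr_shift comp_def)

lemma prob_shifted:
  assumes "Measurable.pred Om Q"
  shows "Om.prob {\<tau>. Q (shift_weight s \<tau>)} = Om.prob {\<tau>. Q \<tau>}"
proof -
  have "Om.prob {\<tau>. Q \<tau>} = measure (distr Om Om (shift_weight s)) {\<tau>. Q \<tau>}"
    by (simp add: distr_shift)
  also have "\<dots> = Om.prob {\<tau>. Q (shift_weight s \<tau>)}"
    using assms by (subst measure_distr) (auto simp: pred_def)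
  finally show ?thesis by simp
qed

lemma indep_coordinates: "Om.indep_vars (\<lambda>_. P) (\<lambda>e \<tau>. \<tau> e) UNIV"
proof -
  have "distr Om P (\<lambda>\<tau>. \<tau> e) = P" for e
    using distr_PiM_component[of UNIV "\<lambda>_. P" e] P.prob_space_axioms by simp
  then show ?thesis
    by (subst Om.indep_vars_iff_distr_eq_PiM) (auto simp: restrict_UNIV distr_id)
qed

lemma indep_disjoint:
  fixes f :: "'i \<Rightarrow> (vertex set \<Rightarrow> real) \<Rightarrow> real"
  assumes "disjoint_family_on E L"
    and "\<And>i. i \<in> L \<Longrightarrow> f i \<in> borel_measurable (Pi\<^sub>M (E i) (\<lambda>_. P))"
    and "\<And>i \<tau>. i \<in> L \<Longrightarrow> f i (restrict \<tau> (E i)) = f i \<tau>"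
  shows "Om.indep_vars (\<lambda>_. borel) f L"
proof -
  have "Om.indep_vars (\<lambda>i. Pi\<^sub>M (E i) (\<lambda>_. P)) (\<lambda>i \<tau>. restrict \<tau> (E i)) L"
    using Om.indep_vars_restrict[OF indep_coordinates, of L E] assms(1) by auto
  then have "Om.indep_vars (\<lambda>_. borel) (\<lambda>i \<tau>. f i (restrict \<tau> (E i))) L"
    by (rule Om.indep_vars_compose2) (use assms in auto)
  then show ?thesis
    by (rule iffD1[OF Om.indep_vars_cong[OF refl _ refl], rotated]) (use assms(3) in auto)
qed

section \<open>The time constant as the growth rate of crossing times\<close>

definition mean_cross :: "nat \<Rightarrow> nat \<Rightarrow> ennreal" where
  "mean_cross K n = (\<integral>\<^sup>+\<tau>. cross d K 0 (int n) (wt \<tau>) \<partial>Om)"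

definition rate :: "nat \<Rightarrow> ennreal" where
  "rate K = (SUP n\<in>{1..}. mean_cross K n / of_nat n)"

lemma rate_ge: "n \<ge> 1 \<Longrightarrow> mean_cross K n \<le> rate K * of_nat n"
proof -
  assume n: "n \<ge> 1"
  then have "mean_cross K n / of_nat n \<le> rate K"
    unfolding rate_def by (intro SUP_upper) auto
  then have "mean_cross K n / of_nat n * of_nat n \<le> rate K * of_nat n"
    by (rule mult_right_mono) auto
  then show ?thesis
    using n by (simp add: ennreal_divide_times ennreal_times_divide ennreal_mult_divide_eq)
qed

lemma SUP_min_of_nat: "(SUP n. min x (of_nat n)) = (x::ennreal)"
  using inf_SUP[of x "\<lambda>n. of_nat n :: ennreal" UNIV]
  by (simp add: ennreal_SUP_of_nat_eq_top inf_min)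

text \<open>
  The crossing time of a long slab is at least the sum of the independent crossing times of its
  blocks of length \<open>k\<close>. Truncating the latter at a high level \<open>M\<close> keeps their mean above \<open>c k\<close> and
  makes Hoeffding's inequality applicable, also if the mean is infinite.
\<close>

lemma prob_cross_less_tendsto_0:
  assumes "c \<ge> 0" "ennreal c < rate K"
  shows "(\<lambda>n. Om.prob {\<tau>. cross d K 0 (int n) (wt \<tau>) < ennreal (c * real n)}) \<longlonglongrightarrow> 0"
proof -
  obtain k where k: "k \<ge> 1" "ennreal c < mean_cross K k / of_nat k"
    using assms(2) unfolding rate_def less_SUP_iff by auto
  have "ennreal (c * real k) < mean_cross K k"
  proof (rule ccontr)
    assume "\<not> ennreal (c * real k) < mean_cross K k"
    then have "mean_cross K k / of_nat k \<le> ennreal (c * real k) / of_nat k"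
      by (intro divide_right_mono_ennreal) auto
    also have "\<dots> = ennreal c"
      using k(1) assms(1) by (simp add: ennreal_of_nat_eq_real_of_nat divide_ennreal)
    finally show False using k(2) by simp
  qed
  also have "mean_cross K k = (\<integral>\<^sup>+\<tau>. (SUP n. min (cross d K 0 (int k) (wt \<tau>)) (of_nat n)) \<partial>Om)"
    by (simp add: mean_cross_def SUP_min_of_nat)
  also have "\<dots> = (SUP n. \<integral>\<^sup>+\<tau>. min (cross d K 0 (int k) (wt \<tau>)) (of_nat n) \<partial>Om)"
    by (intro nn_integral_monotone_convergence_SUP)
       (auto simp: incseq_def le_fun_def intro: min.coboundedI1 min.coboundedI2 order_trans of_nat_mono)
  finally obtain M :: nat where
    M: "ennreal (c * real k) < (\<integral>\<^sup>+\<tau>. min (cross d K 0 (int k) (wt \<tau>)) (of_nat M) \<partial>Om)"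
    unfolding less_SUP_iff by auto
  define g where "g i \<tau> = enn2real (min (cross d K (int (k * i)) (int (k * Suc i)) (wt \<tau>)) (of_nat M))"
    for i :: nat and \<tau> :: "vertex set \<Rightarrow> real"
  have ennreal_g: "ennreal (g i \<tau>) = min (cross d K (int (k * i)) (int (k * Suc i)) (wt \<tau>)) (of_nat M)"
    for i \<tau>
    unfolding g_def by (intro ennreal_enn2real) (auto simp: min_less_iff_disj of_nat_less_top)
  have g_nonneg: "0 \<le> g i \<tau>" for i \<tau>
    by (simp add: g_def)
  have g_le: "g i \<tau> \<le> real M" for i \<tau>
  proof -
    have "ennreal (g i \<tau>) \<le> ennreal (real M)"
      unfolding ennreal_g by (simp add: ennreal_of_nat_eq_real_of_nat)
    then show ?thesis by (simp add: ennreal_le_iff)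
  qed
  have g_meas [measurable]: "g i \<in> borel_measurable Om" for i
    unfolding g_def by measurable
  have "M > 0"
    using M by (cases "M = 0") auto
  define \<mu> where "\<mu> = Om.expectation (g 0)"
  have int_g: "integrable Om (g 0)"
    by (rule Om.integrable_const_bound[of _ "real M"]) (auto simp: g_nonneg g_le)
  have "(\<integral>\<^sup>+\<tau>. min (cross d K 0 (int k) (wt \<tau>)) (of_nat M) \<partial>Om) = (\<integral>\<^sup>+\<tau>. ennreal (g 0 \<tau>) \<partial>Om)"
    by (simp add: ennreal_g)
  also have "\<dots> = ennreal \<mu>"
    unfolding \<mu>_def by (intro nn_integral_eq_integral int_g) (auto simp: g_nonneg)
  finally have "c * real k < \<mu>"
    using M assms(1) by (simp add: ennreal_less_iff)
  \<comment> \<open>half of the gap absorbs the incomplete last block, the other half is the deviation\<close>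
  define \<eta> where "\<eta> = (\<mu> - c * real k) / 2"
  have \<eta>: "\<eta> > 0" "c * real k = \<mu> - 2 * \<eta>"
    using \<open>c * real k < \<mu>\<close> by (auto simp: \<eta>_def field_simps)
  have hoeff: "Om.prob {\<tau>. (\<Sum>i<m. g i \<tau>) \<le> real m * \<mu> - real m * \<eta>} \<le> exp (- (2 * \<eta>\<^sup>2 / (real M)\<^sup>2) * real m)"
    if "m > 0" for m
  proof -
    interpret H: Hoeffding_ineq_iid Om "{..<m}" g "g 0" 0 "real M" \<mu>
    proof unfold_locales
      show "Om.indep_vars (\<lambda>_. borel) g {..<m}"
      proof (rule indep_disjoint[OF disjoint_slabs])
        fix i :: nat
        let ?E = "slab (int (k * i)) (int (k * Suc i))"
        show "g i (restrict \<tau> ?E) = g i \<tau>" for \<tau>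
          unfolding g_def by (subst cross_cong[of _ _ _ "wt \<tau>"]) (auto simp: wt_def)
        have "cross d K (int (k * i)) (int (k * Suc i)) (wt \<tau>) =
            cross d K (int (k * i)) (int (k * Suc i)) (\<lambda>e. if e \<in> ?E then wt \<tau> e else 0)" for \<tau>
          by (rule cross_cong) auto
        moreover have "(\<lambda>\<tau>. if e \<in> ?E then wt \<tau> e else 0) \<in> borel_measurable (Pi\<^sub>M ?E (\<lambda>_. P))" for e
        proof (cases "e \<in> ?E")
          case True
          then have "(\<lambda>\<tau>. \<tau> e) \<in> Pi\<^sub>M ?E (\<lambda>_. P) \<rightarrow>\<^sub>M P"
            by (rule measurable_component_singleton)
          then have "(\<lambda>\<tau>. \<tau> e) \<in> borel_measurable (Pi\<^sub>M ?E (\<lambda>_. P))"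
            by (simp cong: measurable_cong_sets)
          then show ?thesis
            using True by (simp add: wt_def)
        qed auto
        ultimately show "g i \<in> borel_measurable (Pi\<^sub>M ?E (\<lambda>_. P))"
          unfolding g_def using measurable_cross[of "\<lambda>\<tau> e. if e \<in> ?E then wt \<tau> e else 0" "Pi\<^sub>M ?E (\<lambda>_. P)"]
          by simp
      qed
      show "distr Om borel (g i) = distr Om borel (g 0)" for i
      proof -
        have "g i = (\<lambda>\<tau>. g 0 (shift_weight (int (k * i)) \<tau>))"
          by (rule ext) (simp add: g_def wt_shift_weight cross_shift d_pos algebra_simps)
        then show ?thesis
          using distr_shifted[OF g_meas, of 0 "int (k * i)"] by simp
      qed
    qed (auto simp: g_nonneg g_le \<mu>_def)
    have "Om.prob {\<tau> \<in> space Om. (\<Sum>i<m. g i \<tau>) \<le> real (card {..<m}) * \<mu> - real m * \<eta>}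
        \<le> exp (- 2 * (real m * \<eta>)\<^sup>2 / (real (card {..<m}) * (real M - 0)\<^sup>2))"
      using that \<open>M > 0\<close> \<eta> by (intro H.Hoeffding_ineq_le) auto
    also have "- 2 * (real m * \<eta>)\<^sup>2 / (real (card {..<m}) * (real M - 0)\<^sup>2) = - (2 * \<eta>\<^sup>2 / (real M)\<^sup>2) * real m"
      using that \<open>M > 0\<close> by (simp add: field_simps power2_eq_square)
    finally show ?thesis by simp
  qed
  have lim_div: "filterlim (\<lambda>n. n div k) at_top at_top"
    using k(1) by (intro filterlim_at_top_div_const_nat) auto
  have lim_exp: "((\<lambda>m::nat. exp (- (2 * \<eta>\<^sup>2 / (real M)\<^sup>2) * real m)) \<longlongrightarrow> 0) at_top"
  proof -
    have "exp (- (2 * \<eta>\<^sup>2 / (real M)\<^sup>2)) < 1"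
      using \<eta> \<open>M > 0\<close> by simp
    then have "(\<lambda>m. exp (- (2 * \<eta>\<^sup>2 / (real M)\<^sup>2)) ^ m) \<longlonglongrightarrow> 0"
      by (intro LIMSEQ_power_zero) auto
    then show ?thesis
      by (simp add: exp_of_nat_mult[symmetric] mult.commute)
  qed
  have "eventually (\<lambda>m. m > 0 \<and> c * real k \<le> real m * \<eta>) at_top"
  proof (intro eventually_conj eventually_gt_at_top)
    show "eventually (\<lambda>m. c * real k \<le> real m * \<eta>) at_top"
      using eventually_ge_at_top[of "nat \<lceil>c * real k / \<eta>\<rceil>"]
    proof eventually_elim
      case (elim m)
      then have "c * real k / \<eta> \<le> real m" by linarith
      then show ?case using \<eta> by (simp add: field_simps)
    qed
  qed
  then have ev: "eventually (\<lambda>n. n div k > 0 \<and> c * real k \<le> real (n div k) * \<eta>) at_top"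
    using lim_div by (rule eventually_compose_filterlim)
  show ?thesis
  proof (rule tendsto_sandwich[OF _ _ tendsto_const])
    show "\<forall>\<^sub>F n in sequentially. Om.prob {\<tau>. cross d K 0 (int n) (wt \<tau>) < ennreal (c * real n)}
        \<le> exp (- (2 * \<eta>\<^sup>2 / (real M)\<^sup>2) * real (n div k))"
      using ev
    proof eventually_elim
      case (elim n)
      define m where "m = n div k"
      have km: "k * m \<le> n" "real n \<le> real k * (real m + 1)"
      proof -
        show "k * m \<le> n" by (simp add: m_def)
        have "n < k * (n div k) + k"
          using k(1) by (metis add_strict_left_mono less_le_trans mod_less_divisor mult_div_mod_eq zero_less_one)
        then have "n \<le> k * (m + 1)" by (simp add: m_def)
        then have "real n \<le> real (k * (m + 1))" by (rule of_nat_mono)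
        then show "real n \<le> real k * (real m + 1)" by (simp add: algebra_simps)
      qed
      have "{\<tau>. cross d K 0 (int n) (wt \<tau>) < ennreal (c * real n)}
          \<subseteq> {\<tau>. (\<Sum>i<m. g i \<tau>) \<le> real m * \<mu> - real m * \<eta>}"
      proof clarify
        fix \<tau> assume *: "cross d K 0 (int n) (wt \<tau>) < ennreal (c * real n)"
        have "ennreal (\<Sum>i<m. g i \<tau>) = (\<Sum>i<m. ennreal (g i \<tau>))"
          by (simp add: sum_ennreal g_nonneg)
        also have "\<dots> \<le> (\<Sum>i<m. cross d K (int (k * i)) (int (k * Suc i)) (wt \<tau>))"
          by (intro sum_mono) (simp add: ennreal_g)
        also have "\<dots> \<le> cross d K 0 (int n) (wt \<tau>)"
          by (rule sum_cross_le_cross[OF km(1)])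
        also note *
        finally have "(\<Sum>i<m. g i \<tau>) < c * real n"
          by (simp add: ennreal_less_iff sum_nonneg g_nonneg)
        also have "\<dots> \<le> c * (real k * (real m + 1))"
          using km assms(1) by (intro mult_left_mono) auto
        also have "\<dots> = real m * (c * real k) + c * real k"
          by (simp add: algebra_simps)
        also have "\<dots> \<le> real m * \<mu> - real m * \<eta>"
        proof -
          have "real m * (c * real k) = real m * \<mu> - 2 * (real m * \<eta>)"
            unfolding \<eta>(2) by (simp add: algebra_simps)
          moreover have "c * real k \<le> real m * \<eta>"
            using elim by (simp add: m_def)
          ultimately show ?thesis by linarith
        qed
        finally show "(\<Sum>i<m. g i \<tau>) \<le> real m * \<mu> - real m * \<eta>" by simp
      qed
      then have "Om.prob {\<tau>. cross d K 0 (int n) (wt \<tau>) < ennreal (c * real n)}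
          \<le> Om.prob {\<tau>. (\<Sum>i<m. g i \<tau>) \<le> real m * \<mu> - real m * \<eta>}"
        by (intro Om.finite_measure_mono events_Collect) auto
      also have "\<dots> \<le> exp (- (2 * \<eta>\<^sup>2 / (real M)\<^sup>2) * real m)"
        using elim by (intro hoeff) (simp add: m_def)
      finally show ?case by (simp add: m_def)
    qed
    show "(\<lambda>n. exp (- (2 * \<eta>\<^sup>2 / (real M)\<^sup>2) * real (n div k))) \<longlonglongrightarrow> 0"
      using filterlim_compose[OF lim_exp lim_div] by simp
  qed auto
qed

text \<open>
  Let \<open>X\<close> be the crossing time divided by \<open>n\<close> and \<open>r\<close> the rate. With \<open>b\<close> slightly below \<open>r\<close>, the
  bounds \<open>r \<ge> E X \<ge> b P(X \<ge> b) + (c - b) P(X \<ge> c)\<close> and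
  \<open>P(X \<ge> b) \<rightarrow> 1\<close> leave no room for \<open>P(X \<ge> c)\<close>.
\<close>

lemma prob_cross_ge_tendsto_0:
  assumes "rate K < \<top>" "enn2real (rate K) < c"
  shows "(\<lambda>n. Om.prob {\<tau>. ennreal (c * real n) \<le> cross d K 0 (int n) (wt \<tau>)}) \<longlonglongrightarrow> 0"
proof -
  define r where "r = enn2real (rate K)"
  have r: "0 \<le> r" "rate K = ennreal r" "r < c"
    using assms by (auto simp: r_def)
  let ?q = "\<lambda>n. Om.prob {\<tau>. ennreal (c * real n) \<le> cross d K 0 (int n) (wt \<tau>)}"
  show ?thesis
  proof (rule LIMSEQ_I)
    fix \<epsilon> :: real assume "\<epsilon> > 0"
    \<comment> \<open>truncated at \<open>0\<close>, where the bound on the lower tail is trivial\<close>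
    define b where "b = max 0 (r - \<epsilon> * (c - r) / 4)"
    have b: "0 \<le> b" "r - b \<le> \<epsilon> * (c - r) / 4" "b \<le> r"
      using r \<open>\<epsilon> > 0\<close> by (auto simp: b_def max_def)
    let ?p = "\<lambda>n. Om.prob {\<tau>. cross d K 0 (int n) (wt \<tau>) < ennreal (b * real n)}"
    have "?p \<longlonglongrightarrow> 0"
    proof (cases "b = 0")
      case False
      then have "b < r" using r \<open>\<epsilon> > 0\<close> by (auto simp: b_def max_def split: if_splits)
      then show ?thesis
        using b r by (intro prob_cross_less_tendsto_0) (auto simp: ennreal_less_iff)
    qed auto
    moreover have "\<epsilon> * (c - r) / (4 * (b + 1)) > 0"
      using r b \<open>\<epsilon> > 0\<close> by auto
    ultimately have "eventually (\<lambda>n. ?p n < \<epsilon> * (c - r) / (4 * (b + 1))) sequentially"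
      by (rule order_tendstoD)
    then have "eventually (\<lambda>n. norm (?q n - 0) < \<epsilon>) sequentially"
      using eventually_ge_at_top[of 1]
    proof eventually_elim
      case (elim n)
      let ?X = "\<lambda>\<tau>. cross d K 0 (int n) (wt \<tau>)"
      let ?A = "{\<tau>. ennreal (b * real n) \<le> ?X \<tau>}" and ?B = "{\<tau>. ennreal (c * real n) \<le> ?X \<tau>}"
      have sets: "?A \<in> sets Om" "?B \<in> sets Om"
        by (intro events_Collect; measurable)+
      have "{\<tau>. ?X \<tau> < ennreal (b * real n)} = space Om - ?A"
        by auto
      then have pA: "Om.prob ?A = 1 - ?p n"
        using Om.prob_compl[OF sets(1)] by simp
      have "ennreal (b * real n * Om.prob ?A + (c - b) * real n * Om.prob ?B) =
          (\<integral>\<^sup>+\<tau>. ennreal (b * real n) * indicator ?A \<tau> + ennreal ((c - b) * real n) * indicator ?B \<tau> \<partial>Om)"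
        using b r sets
        by (subst nn_integral_add) (auto simp: nn_integral_cmult_indicator Om.emeasure_eq_measure
            ennreal_mult'' ennreal_plus simp del: ennreal_plus[symmetric])
      also have "\<dots> \<le> mean_cross K n"
        unfolding mean_cross_def
      proof (rule nn_integral_mono)
        fix \<tau>
        have "ennreal (b * real n) + ennreal ((c - b) * real n) = ennreal (c * real n)"
        proof -
          have "ennreal (b * real n + (c - b) * real n) = ennreal (b * real n) + ennreal ((c - b) * real n)"
            using b r by (intro ennreal_plus) auto
          then show ?thesis by (simp add: algebra_simps)
        qed
        moreover have "ennreal (b * real n) \<le> ennreal (c * real n)"
          using b r by (intro ennreal_leI mult_right_mono) auto
        ultimately show "ennreal (b * real n) * indicator ?A \<tau> + ennreal ((c - b) * real n) * indicator ?B \<tau> \<le> ?X \<tau>"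
          by (auto simp: indicator_def)
      qed
      also have "\<dots> \<le> rate K * of_nat n"
        using elim by (intro rate_ge) auto
      also have "\<dots> = ennreal (r * real n)"
        using r by (simp add: ennreal_mult'' ennreal_of_nat_eq_real_of_nat)
      finally have "b * real n * Om.prob ?A + (c - b) * real n * Om.prob ?B \<le> r * real n"
        using r by (simp add: ennreal_le_iff)
      then have "real n * (b * Om.prob ?A + (c - b) * Om.prob ?B) \<le> real n * r"
        by (simp add: algebra_simps)
      then have "b * Om.prob ?A + (c - b) * ?q n \<le> r"
        using elim by (simp add: mult_le_cancel_left)
      then have "(c - b) * ?q n \<le> (r - b) + b * ?p n"
        by (simp add: pA algebra_simps)
      moreover have "(c - r) * ?q n \<le> (c - b) * ?q n"
        using b by (intro mult_right_mono) auto
      moreover have "b * ?p n \<le> \<epsilon> * (c - r) / 4"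
      proof -
        have "b * ?p n \<le> (b + 1) * (\<epsilon> * (c - r) / (4 * (b + 1)))"
          using elim b by (intro mult_mono) auto
        also have "\<dots> = \<epsilon> * (c - r) / 4" using b by (simp add: field_simps)
        finally show ?thesis .
      qed
      ultimately have "(c - r) * ?q n \<le> (c - r) * (\<epsilon> / 2)"
        using b by (simp add: field_simps)
      then have "?q n \<le> \<epsilon> / 2"
        using r by (simp add: mult_le_cancel_left)
      then show ?case using \<open>\<epsilon> > 0\<close> by simp
    qed
    then show "\<exists>N. \<forall>n\<ge>N. norm (?q n - 0) < \<epsilon>"
      by (simp add: eventually_sequentially)
  qed
qed

text \<open>
  The column costs are finite and identically distributed, hence tight.
\<close>

lemma prob_column_cost_tendsto_0:
  assumes "\<epsilon> > 0"
  shows "(\<lambda>n. Om.prob {\<tau>. ennreal (\<epsilon> * real n) \<le> column_cost d K (s n) (wt \<tau>)}) \<longlonglongrightarrow> 0"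
proof -
  let ?A = "\<lambda>n. {\<tau>. ennreal (\<epsilon> * real n) \<le> column_cost d K 0 (wt \<tau>)}"
  have "(\<lambda>n. Om.prob (?A n)) \<longlonglongrightarrow> Om.prob (\<Inter>n. ?A n)"
  proof (rule Om.finite_Lim_measure_decseq)
    show "decseq ?A"
      using assms by (force simp: decseq_def intro: order_trans[rotated] ennreal_leI mult_left_mono)
  qed (auto intro!: events_Collect)
  moreover have "(\<Inter>n. ?A n) = {}"
  proof (intro equals0I)
    fix \<tau> assume *: "\<tau> \<in> (\<Inter>n. ?A n)"
    have "column_cost d K 0 (wt \<tau>) < \<top>"
      by (rule column_cost_finite[OF d_pos]) (simp add: wt_def)
    then obtain x where x: "column_cost d K 0 (wt \<tau>) = ennreal x" "x \<ge> 0"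
      by (cases "column_cost d K 0 (wt \<tau>)") auto
    obtain n :: nat where "x / \<epsilon> < real n"
      using reals_Archimedean2 by blast
    then have "x < \<epsilon> * real n"
      using assms by (simp add: field_simps)
    moreover have "ennreal (\<epsilon> * real n) \<le> ennreal x"
      using * x by auto
    ultimately show False
      using x by (simp add: ennreal_le_iff)
  qed
  moreover have "Om.prob {\<tau>. ennreal (\<epsilon> * real n) \<le> column_cost d K (s n) (wt \<tau>)} = Om.prob (?A n)" for n
    using prob_shifted[of "\<lambda>\<tau>. ennreal (\<epsilon> * real n) \<le> column_cost d K 0 (wt \<tau>)" "s n"]
    by (simp add: wt_shift_weight column_cost_shift d_pos)
  ultimately show ?thesis by simp
qed

lemma prob_pdist_less_tendsto_0:
  assumes "K > 0" "c \<ge> 0" "ennreal c < rate K"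
  shows "(\<lambda>n. Om.prob {\<tau>. pdist d K (wt \<tau>) (axis_vertex 0) (axis_vertex (int n)) < ennreal (c * real n)}) \<longlonglongrightarrow> 0"
proof (rule tendsto_sandwich[OF _ _ tendsto_const prob_cross_less_tendsto_0[OF assms(2,3)]])
  show "\<forall>\<^sub>F n in sequentially.
      Om.prob {\<tau>. pdist d K (wt \<tau>) (axis_vertex 0) (axis_vertex (int n)) < ennreal (c * real n)}
      \<le> Om.prob {\<tau>. cross d K 0 (int n) (wt \<tau>) < ennreal (c * real n)}"
  proof (intro always_eventually allI Om.finite_measure_mono)
    fix n
    have "cross d K 0 (int n) (wt \<tau>) \<le> pdist d K (wt \<tau>) (axis_vertex 0) (axis_vertex (int n))" for \<tau>
      using d_pos assms by (intro cross_le_pdist) auto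
    then show "{\<tau>. pdist d K (wt \<tau>) (axis_vertex 0) (axis_vertex (int n)) < ennreal (c * real n)}
        \<subseteq> {\<tau>. cross d K 0 (int n) (wt \<tau>) < ennreal (c * real n)}"
      by (auto intro: le_less_trans)
  qed (auto intro!: events_Collect)
qed auto

lemma prob_pdist_ge_tendsto_0:
  assumes "K > 0" "rate K < \<top>" "enn2real (rate K) < c"
  shows "(\<lambda>n. Om.prob {\<tau>. ennreal (c * real n) \<le> pdist d K (wt \<tau>) (axis_vertex 0) (axis_vertex (int n))}) \<longlonglongrightarrow> 0"
proof -
  define r where "r = enn2real (rate K)"
  define \<epsilon> where "\<epsilon> = (c - r) / 4"
  have r: "0 \<le> r" "\<epsilon> > 0" "c = (r + \<epsilon>) + \<epsilon> + \<epsilon> + \<epsilon>"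
    using assms by (auto simp: r_def \<epsilon>_def field_simps)
  let ?C = "\<lambda>n. {\<tau>. ennreal ((r + \<epsilon>) * real n) \<le> cross d K 0 (int n) (wt \<tau>)}"
  let ?W = "\<lambda>s n. {\<tau>. ennreal (\<epsilon> * real n) \<le> column_cost d K (s n) (wt \<tau>)}"
  have "(\<lambda>n. Om.prob (?C n) + (Om.prob (?W (\<lambda>_. 0) n) + Om.prob (?W int n))) \<longlonglongrightarrow> 0 + (0 + 0)"
    using r assms
    by (intro tendsto_add prob_cross_ge_tendsto_0 prob_column_cost_tendsto_0) (auto simp: r_def)
  then have lim: "(\<lambda>n. Om.prob (?C n) + (Om.prob (?W (\<lambda>_. 0) n) + Om.prob (?W int n))) \<longlonglongrightarrow> 0" by simp
  show ?thesis
  proof (rule tendsto_sandwich[OF _ _ tendsto_const lim])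
    show "\<forall>\<^sub>F n in sequentially.
        Om.prob {\<tau>. ennreal (c * real n) \<le> pdist d K (wt \<tau>) (axis_vertex 0) (axis_vertex (int n))}
        \<le> Om.prob (?C n) + (Om.prob (?W (\<lambda>_. 0) n) + Om.prob (?W int n))"
      using eventually_gt_at_top[of 0]
    proof eventually_elim
      case (elim n)
      let ?T = "{\<tau>. ennreal (c * real n) \<le> pdist d K (wt \<tau>) (axis_vertex 0) (axis_vertex (int n))}"
      have "?T \<subseteq> ?C n \<union> (?W (\<lambda>_. 0) n \<union> ?W int n)"
      proof (rule subsetI, rule ccontr)
        fix \<tau> assume \<tau>: "\<tau> \<in> ?T" "\<tau> \<notin> ?C n \<union> (?W (\<lambda>_. 0) n \<union> ?W int n)"
        have "pdist d K (wt \<tau>) (axis_vertex 0) (axis_vertex (int n)) \<le>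
            column_cost d K 0 (wt \<tau>) + column_cost d K (int n) (wt \<tau>) + cross d K 0 (int n) (wt \<tau>)"
          using d_pos assms elim by (intro pdist_le_cross) auto
        also have "\<dots> \<le> ennreal (\<epsilon> * real n) + ennreal (\<epsilon> * real n) + ennreal ((r + \<epsilon>) * real n)"
          using \<tau>(2) by (intro add_mono) auto
        also have "\<dots> = ennreal ((r + \<epsilon> + \<epsilon> + \<epsilon>) * real n)"
          using r by (simp add: ennreal_plus[symmetric] algebra_simps del: ennreal_plus)
        also have "\<dots> < ennreal (c * real n)"
          using r elim by (intro ennreal_lessI) (auto intro!: mult_strict_right_mono)
        finally show False using \<tau>(1) by auto
      qed
      then have "Om.prob ?T \<le> Om.prob (?C n \<union> (?W (\<lambda>_. 0) n \<union> ?W int n))"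
        by (intro Om.finite_measure_mono sets.Un events_Collect) auto
      also have "\<dots> \<le> Om.prob (?C n) + Om.prob (?W (\<lambda>_. 0) n \<union> ?W int n)"
        by (intro measure_Un_le sets.Un events_Collect) auto
      also have "\<dots> \<le> Om.prob (?C n) + (Om.prob (?W (\<lambda>_. 0) n) + Om.prob (?W int n))"
        by (intro add_left_mono measure_Un_le events_Collect) auto
      finally show ?case .
    qed
  qed auto
qed

end

section \<open>Convergence in probability of the passage times\<close>

lemma path_edges_in_tube: "p \<in> tube_paths d K u v \<Longrightarrow> set (path_edges p) \<subseteq> tube_edges d K"
proof -
  have "set (path_edges p) \<subseteq> tube_edges d K"
    if "p \<noteq> []" "set p \<subseteq> tube_vertices d K" "successively (neighbours d) p" for p
    using that by (induction p rule: induct_list012) (auto simp: tube_edges_def)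
  then show "p \<in> tube_paths d K u v \<Longrightarrow> set (path_edges p) \<subseteq> tube_edges d K"
    by (auto simp: tube_paths_def)
qed

lemma path_time_nonneg:
  assumes "\<And>e. e \<in> tube_edges d K \<Longrightarrow> 0 \<le> \<tau> e" "p \<in> tube_paths d K u v"
  shows "0 \<le> path_time \<tau> p" and "ennreal (path_time \<tau> p) = (\<Sum>e\<leftarrow>path_edges p. wt \<tau> e)"
proof -
  have "0 \<le> \<tau> e" if "e \<in> set (path_edges p)" for e
    using assms path_edges_in_tube that by blast
  then have "0 \<le> sum_list (map \<tau> es) \<and> ennreal (sum_list (map \<tau> es)) = (\<Sum>e\<leftarrow>es. wt \<tau> e)"
    if "set es \<subseteq> set (path_edges p)" for es
    using that by (induction es) (auto simp: wt_def ennreal_plus simp del: ennreal_plus[symmetric])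
  then show "0 \<le> path_time \<tau> p" "ennreal (path_time \<tau> p) = (\<Sum>e\<leftarrow>path_edges p. wt \<tau> e)"
    by (auto simp: path_time_def)
qed

lemma tube_paths_axis_nonempty:
  assumes "d > 0" "K > 0"
  shows "tube_paths d K (axis_vertex 0) (axis_vertex (int n)) \<noteq> {}"
proof -
  have "pdist d K (\<lambda>_. 1) (axis_vertex 0) (translate (int n) (axis_vertex 0)) \<le> of_nat n * 1"
    using assms by (intro pdist_row_le) auto
  then have "pdist d K (\<lambda>_. 1) (axis_vertex 0) (axis_vertex (int n)) < \<top>"
    by (auto simp: of_nat_less_top intro: le_less_trans)
  then show ?thesis by (auto simp: pdist_def)
qed

lemma ennreal_passage_time:
  assumes "\<And>e. e \<in> tube_edges d K \<Longrightarrow> 0 \<le> \<tau> e" "tube_paths d K u v \<noteq> {}"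
  shows "0 \<le> passage_time d K \<tau> u v" and "ennreal (passage_time d K \<tau> u v) = pdist d K (wt \<tau>) u v"
proof -
  let ?T = "passage_time d K \<tau> u v"
  note path = path_time_nonneg[of d K \<tau> _ u v, OF assms(1)]
  have bdd: "bdd_below (path_time \<tau> ` tube_paths d K u v)"
    by (rule bdd_belowI2[of _ 0]) (rule path)
  show nn: "0 \<le> ?T"
    unfolding passage_time_def using assms(2) by (intro cINF_greatest path) auto
  show "ennreal ?T = pdist d K (wt \<tau>) u v"
  proof (rule antisym)
    show "ennreal ?T \<le> pdist d K (wt \<tau>) u v"
      unfolding pdist_def
    proof (rule INF_greatest)
      fix p assume p: "p \<in> tube_paths d K u v"
      have "?T \<le> path_time \<tau> p"
        unfolding passage_time_def by (rule cINF_lower[OF bdd p])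
      then show "ennreal ?T \<le> (\<Sum>e\<leftarrow>path_edges p. wt \<tau> e)"
        using path(2)[OF _ p] by (metis ennreal_leI assms(1))
    qed
    have le: "pdist d K (wt \<tau>) u v \<le> ennreal (path_time \<tau> p)" if "p \<in> tube_paths d K u v" for p
      unfolding pdist_def using that path(2)[of p] assms(1) by (intro INF_lower2[OF that]) auto
    obtain p0 where "p0 \<in> tube_paths d K u v" using assms(2) by auto
    then have fin: "pdist d K (wt \<tau>) u v < \<top>"
      using le[of p0] by (auto intro: le_less_trans)
    have "enn2real (pdist d K (wt \<tau>) u v) \<le> ?T"
      unfolding passage_time_def
    proof (rule cINF_greatest[OF assms(2)])
      fix p assume p: "p \<in> tube_paths d K u v"
      show "enn2real (pdist d K (wt \<tau>) u v) \<le> path_time \<tau> p"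
        using le[OF p] path(1)[OF _ p] assms(1) by (intro enn2real_leI) auto
    qed
    then show "pdist d K (wt \<tau>) u v \<le> ennreal ?T"
      using fin by (metis ennreal_enn2real ennreal_leI)
  qed
qed

text \<open>
  The value of \<open>Inf\<close> on a set that is unbounded below is a fixed default. It may occur on the null set
  of environments with negative passage times, and convergence in probability demands measurability
  there, too.
\<close>

lemma real_INF_unbounded:
  fixes f :: "'i \<Rightarrow> real"
  assumes "\<not> bdd_below (f ` A)"
  shows "(INF i\<in>A. f i) = - (LEAST z::real. False)"
proof -
  have unbounded: "\<not> (\<forall>x\<in>uminus ` f ` A. x \<le> z)" for z
  proof
    assume "\<forall>x\<in>uminus ` f ` A. x \<le> z"
    then have "bdd_below (f ` A)" by (intro bdd_belowI[of _ "- z"]) force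
    then show False using assms by simp
  qed
  have "(\<lambda>z. \<forall>x\<in>uminus ` f ` A. x \<le> z) = (\<lambda>z. False)"
    by (rule ext) (simp only: unbounded)
  then show ?thesis
    unfolding Inf_real_def Sup_real_def by simp
qed

lemma borel_measurable_real_INF:
  fixes f :: "'i \<Rightarrow> 'a \<Rightarrow> real"
  assumes A: "countable A" "A \<noteq> {}" and f [measurable]: "\<And>i. i \<in> A \<Longrightarrow> f i \<in> borel_measurable M"
  shows "(\<lambda>x. INF i\<in>A. f i x) \<in> borel_measurable M"
proof -
  let ?I = "\<lambda>x. INF i\<in>A. ereal (f i x)"
  have I [measurable]: "?I \<in> borel_measurable M"
    using A f by (intro borel_measurable_INF) auto
  have "(INF i\<in>A. f i x) = (if ?I x = -\<infinity> then - (LEAST z::real. False) else real_of_ereal (?I x))" for x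
  proof (cases "bdd_below ((\<lambda>i. f i x) ` A)")
    case True
    then obtain b where b: "\<And>i. i \<in> A \<Longrightarrow> b \<le> f i x"
      by (auto simp: bdd_below_def)
    have "ereal b \<le> ?I x"
      using b by (intro INF_greatest) auto
    moreover have "ereal (INF i\<in>A. f i x) = ?I x"
      using ereal_Inf'[OF True] A by (simp add: image_comp)
    ultimately show ?thesis
      by (metis real_of_ereal.simps(1) MInfty_neq_ereal(1))
  next
    case False
    have "?I x = -\<infinity>"
    proof (rule ccontr)
      assume *: "?I x \<noteq> -\<infinity>"
      obtain i where i: "i \<in> A" using A by auto
      have "?I x \<le> ereal (f i x)" by (rule INF_lower[OF i])
      with * obtain b where b: "?I x = ereal b" by (cases "?I x") auto
      have "b \<le> f i x" if "i \<in> A" for i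
        using INF_lower[OF that, of "\<lambda>i. ereal (f i x)"] b by simp
      then show False using False by (auto simp: bdd_below_def)
    qed
    then show ?thesis using real_INF_unbounded[OF False] by simp
  qed
  then show ?thesis by simp
qed

context passage_environment
begin

lemma measurable_passage_time:
  assumes "tube_paths d K u v \<noteq> {}" "sets P' = sets borel"
  shows "(\<lambda>\<tau>. passage_time d K \<tau> u v) \<in> borel_measurable (Pi\<^sub>M (tube_edges d K) (\<lambda>_. P'))"
  unfolding passage_time_def
proof (intro borel_measurable_real_INF countable_tube_paths assms)
  fix p assume "p \<in> tube_paths d K u v"
  then have "set (path_edges p) \<subseteq> tube_edges d K" by (rule path_edges_in_tube)
  then have "(\<lambda>\<tau>. \<Sum>e\<leftarrow>es. \<tau> e) \<in> borel_measurable (Pi\<^sub>M (tube_edges d K) (\<lambda>_. P'))"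
    if "set es \<subseteq> set (path_edges p)" for es
    using that
  proof (induction es)
    case (Cons e es)
    then have "e \<in> tube_edges d K" by auto
    then have "(\<lambda>\<tau>. \<tau> e) \<in> Pi\<^sub>M (tube_edges d K) (\<lambda>_. P') \<rightarrow>\<^sub>M P'"
      by (rule measurable_component_singleton)
    then have "(\<lambda>\<tau>. \<tau> e) \<in> borel_measurable (Pi\<^sub>M (tube_edges d K) (\<lambda>_. P'))"
      using measurable_cong_sets[OF refl assms(2)] by auto
    then show ?case using Cons by auto
  qed auto
  then show "(\<lambda>\<tau>. path_time \<tau> p) \<in> borel_measurable (Pi\<^sub>M (tube_edges d K) (\<lambda>_. P'))"
    unfolding path_time_def by blast
qed

lemma passage_time_restrict:
  "passage_time d K (restrict \<tau> (tube_edges d K)) u v = passage_time d K \<tau> u v"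
proof -
  have "path_time (restrict \<tau> (tube_edges d K)) p = path_time \<tau> p" if "p \<in> tube_paths d K u v" for p
    using path_edges_in_tube[OF that] unfolding path_time_def
    by (intro arg_cong[where f = sum_list] map_cong) auto
  then show ?thesis by (simp add: passage_time_def)
qed

abbreviation speed :: "nat \<Rightarrow> nat \<Rightarrow> (vertex set \<Rightarrow> real) \<Rightarrow> real" where
  "speed K n \<tau> \<equiv> passage_time d K \<tau> (axis_point 0) (axis_point n) / real n"

lemma AE_tube_nonneg: "AE \<tau> in Om. \<forall>e\<in>tube_edges d K. 0 \<le> \<tau> e"
proof -
  have "countable (tube_edges d K)"
    by (rule countable_subset[of _ "(\<lambda>(x, y). {x, y}) ` (tube_vertices d K \<times> tube_vertices d K)"])
       (auto simp: tube_edges_def countable_tube_vertices)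
  moreover have "AE \<tau> in Om. 0 \<le> \<tau> e" for e
    using nonneg P.prob_space_axioms by (intro AE_PiM_component) auto
  ultimately show ?thesis
    by (simp add: AE_ball_countable)
qed

lemma axis_point_eq: "axis_point n = axis_vertex (int n)"
  by (simp add: axis_point_def axis_vertex_def)

lemma tendsto_in_prob_speed:
  assumes "K > 0"
  shows "tendsto_in_prob (fpp_measure d K P) (speed K) (enn2ereal (rate K))"
  unfolding tendsto_in_prob_def
proof (intro conjI allI impI)
  let ?E = "tube_edges d K"
  have paths: "tube_paths d K (axis_point 0) (axis_point n) \<noteq> {}" for n
    using tube_paths_axis_nonempty[OF d_pos assms, of n] by (simp add: axis_point_eq)
  show meas: "speed K n \<in> borel_measurable (fpp_measure d K P)" for n
    unfolding fpp_measure_def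
    by (intro borel_measurable_divide measurable_passage_time paths) auto
  fix U :: "ereal set" assume "open U \<and> enn2ereal (rate K) \<in> U"
  then have U: "open U" "enn2ereal (rate K) \<in> U" by auto
  have restr: "(\<lambda>\<tau>. restrict \<tau> ?E) \<in> Om \<rightarrow>\<^sub>M fpp_measure d K P"
    using measurable_Om_reindex[where I = ?E and f = "\<lambda>e. e"] by (simp add: fpp_measure_def)
  have "distr Om (fpp_measure d K P) (\<lambda>\<tau>. restrict \<tau> ?E) = fpp_measure d K P"
    using distr_Om_reindex[where I = ?E and f = "\<lambda>e. e"] by (simp add: fpp_measure_def)
  have U_meas: "{x. ereal x \<notin> U} \<in> sets borel"
  proof -
    have "closed (ereal -` (- U))"
      using U by (intro closed_vimage) (auto intro: continuous_on_ereal continuous_on_id)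
    then show ?thesis by (simp add: vimage_def)
  qed
  have eq: "measure (fpp_measure d K P) {\<tau> \<in> space (fpp_measure d K P). ereal (speed K n \<tau>) \<notin> U}
      = Om.prob {\<tau>. ereal (speed K n \<tau>) \<notin> U}" (is "measure ?F (?A n) = _") for n
  proof -
    have A: "?A n \<in> sets ?F"
      using measurable_sets[OF meas U_meas, of n] by (simp add: vimage_def Int_def conj_commute)
    have "measure ?F (?A n) = measure (distr Om ?F (\<lambda>\<tau>. restrict \<tau> ?E)) (?A n)"
      using \<open>distr _ _ _ = _\<close> by simp
    also have "\<dots> = Om.prob ((\<lambda>\<tau>. restrict \<tau> ?E) -` ?A n \<inter> space Om)"
      by (rule measure_distr[OF restr A])
    also have "(\<lambda>\<tau>. restrict \<tau> ?E) -` ?A n \<inter> space Om = {\<tau>. ereal (speed K n \<tau>) \<notin> U}"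
      using measurable_space[OF restr] by (auto simp: passage_time_restrict)
    finally show ?thesis .
  qed
  let ?T = "\<lambda>n \<tau>. pdist d K (wt \<tau>) (axis_vertex 0) (axis_vertex (int n))"
  have speed_eq: "AE \<tau> in Om. \<forall>n. 0 \<le> speed K n \<tau> \<and> (n > 0 \<longrightarrow> ?T n \<tau> = ennreal (speed K n \<tau> * real n))"
    using AE_tube_nonneg[of K]
  proof eventually_elim
    case (elim \<tau>)
    show ?case
      using ennreal_passage_time[of d K \<tau> "axis_point 0" "axis_point n" for n, OF _ paths] elim
      by (auto simp: axis_point_eq)
  qed
  have bound: "Om.prob {\<tau>. ereal (speed K n \<tau>) \<notin> U} \<le> Om.prob B"
    if "B \<in> Om.events" and "\<And>\<tau>. 0 \<le> speed K n \<tau> \<Longrightarrow> ?T n \<tau> = ennreal (speed K n \<tau> * real n) \<Longrightarrow>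
      ereal (speed K n \<tau>) \<notin> U \<Longrightarrow> \<tau> \<in> B" "n > 0" for B n
  proof (rule Om.finite_measure_mono_AE[OF _ that(1)])
    show "AE \<tau> in Om. \<tau> \<in> {\<tau>. ereal (speed K n \<tau>) \<notin> U} \<longrightarrow> \<tau> \<in> B"
      using speed_eq by eventually_elim (use that in auto)
  qed
  have lim: "(\<lambda>n. Om.prob {\<tau>. ereal (speed K n \<tau>) \<notin> U}) \<longlonglongrightarrow> 0"
  proof (cases "rate K = \<top>")
    case True
    then obtain m where m: "{ereal m<..} \<subseteq> U"
      using open_PInfty[of U] U by auto
    define c where "c = max m 0 + 1"
    have c: "c > 0" "c > m" by (auto simp: c_def)
    show ?thesis
    proof (rule tendsto_sandwich[OF _ _ tendsto_const])
      show "(\<lambda>n. Om.prob {\<tau>. ?T n \<tau> < ennreal (c * real n)}) \<longlonglongrightarrow> 0"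
        using True assms c by (intro prob_pdist_less_tendsto_0) auto
      show "\<forall>\<^sub>F n in sequentially. Om.prob {\<tau>. ereal (speed K n \<tau>) \<notin> U} \<le> Om.prob {\<tau>. ?T n \<tau> < ennreal (c * real n)}"
        using eventually_gt_at_top[of 0]
      proof eventually_elim
        case (elim n)
        show ?case
        proof (rule bound[OF _ _ elim])
          fix \<tau> assume *: "0 \<le> speed K n \<tau>" "?T n \<tau> = ennreal (speed K n \<tau> * real n)"
            "ereal (speed K n \<tau>) \<notin> U"
          have "speed K n \<tau> \<le> m"
            using m *(3) by (meson ereal_less(2) greaterThan_iff less_ereal.simps(1) not_le subsetD)
          then have "speed K n \<tau> * real n < c * real n"
            using c elim by (intro mult_strict_right_mono) auto
          then show "\<tau> \<in> {\<tau>. ?T n \<tau> < ennreal (c * real n)}"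
            using *(2) c elim by (auto intro!: ennreal_lessI)
        qed (intro events_Collect; measurable)
      qed
    qed auto
  next
    case False
    define r where "r = enn2real (rate K)"
    have r: "0 \<le> r" "rate K = ennreal r"
      using False by (auto simp: r_def less_top)
    have "ereal r \<in> U"
      using U r by (simp add: enn2ereal_ennreal)
    then obtain \<epsilon> where \<epsilon>: "\<epsilon> > 0" "{ereal r - ereal \<epsilon> <..< ereal r + ereal \<epsilon>} \<subseteq> U"
    proof -
      have "\<bar>ereal r\<bar> \<noteq> \<infinity>" by simp
      from ereal_open_cont_interval[OF U(1) \<open>ereal r \<in> U\<close> this] obtain e
        where "e > 0" "{ereal r - e <..< ereal r + e} \<subseteq> U" by auto
      then show ?thesis
      proof (cases e)
        case (real x)
        then show ?thesis using that[of x] \<open>e > 0\<close> \<open>_ \<subseteq> U\<close> by auto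
      next
        case PInf
        have "{ereal r - ereal 1 <..< ereal r + ereal 1} \<subseteq> {ereal r - e <..< ereal r + e}"
          using PInf by auto
        then show ?thesis using that[of 1] \<open>_ \<subseteq> U\<close> by auto
      qed (use \<open>e > 0\<close> in auto)
    qed
    define b where "b = max 0 (r - \<epsilon> / 2)"
    have b: "b \<ge> 0" "b > r - \<epsilon>" using \<epsilon> by (auto simp: b_def)
    have low: "(\<lambda>n. Om.prob {\<tau>. ?T n \<tau> < ennreal (b * real n)}) \<longlonglongrightarrow> 0"
    proof (cases "b = 0")
      case False
      then have "b < r" using \<epsilon> by (auto simp: b_def max_def split: if_splits)
      then show ?thesis
        using r b assms by (intro prob_pdist_less_tendsto_0) (auto simp: ennreal_less_iff)
    qed auto
    have high: "(\<lambda>n. Om.prob {\<tau>. ennreal ((r + \<epsilon>) * real n) \<le> ?T n \<tau>}) \<longlonglongrightarrow> 0"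
      using r \<epsilon> assms by (intro prob_pdist_ge_tendsto_0) auto
    show ?thesis
    proof (rule tendsto_sandwich[OF _ _ tendsto_const])
      show "(\<lambda>n. Om.prob {\<tau>. ?T n \<tau> < ennreal (b * real n)}
          + Om.prob {\<tau>. ennreal ((r + \<epsilon>) * real n) \<le> ?T n \<tau>}) \<longlonglongrightarrow> 0"
        using tendsto_add[OF low high] by simp
      show "\<forall>\<^sub>F n in sequentially. Om.prob {\<tau>. ereal (speed K n \<tau>) \<notin> U}
          \<le> Om.prob {\<tau>. ?T n \<tau> < ennreal (b * real n)}
            + Om.prob {\<tau>. ennreal ((r + \<epsilon>) * real n) \<le> ?T n \<tau>}"
        using eventually_gt_at_top[of 0]
      proof eventually_elim
        case (elim n)
        have ev: "{\<tau>. ?T n \<tau> < ennreal (b * real n)} \<in> Om.events"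
          "{\<tau>. ennreal ((r + \<epsilon>) * real n) \<le> ?T n \<tau>} \<in> Om.events"
          by (intro events_Collect; measurable)+
        have "Om.prob {\<tau>. ereal (speed K n \<tau>) \<notin> U} \<le>
          Om.prob ({\<tau>. ?T n \<tau> < ennreal (b * real n)} \<union> {\<tau>. ennreal ((r + \<epsilon>) * real n) \<le> ?T n \<tau>})"
        proof (rule bound[OF sets.Un[OF ev] _ elim])
          fix \<tau> assume *: "0 \<le> speed K n \<tau>" "?T n \<tau> = ennreal (speed K n \<tau> * real n)"
            "ereal (speed K n \<tau>) \<notin> U"
          have "ereal (speed K n \<tau>) \<notin> {ereal r - ereal \<epsilon> <..< ereal r + ereal \<epsilon>}"
            using \<epsilon> *(3) by blast
          then consider "speed K n \<tau> \<le> r - \<epsilon>" | "r + \<epsilon> \<le> speed K n \<tau>"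
            by (auto simp: not_less)
          then show "\<tau> \<in> {\<tau>. ?T n \<tau> < ennreal (b * real n)} \<union> {\<tau>. ennreal ((r + \<epsilon>) * real n) \<le> ?T n \<tau>}"
          proof cases
            case 1
            then have "speed K n \<tau> * real n < b * real n"
              using b elim by (intro mult_strict_right_mono) auto
            then have "ennreal (speed K n \<tau> * real n) < ennreal (b * real n)"
              using mult_nonneg_nonneg[OF *(1), of "real n"] by (intro iffD2[OF ennreal_less_iff]) simp_all
            then show ?thesis using *(2) by simp
          next
            case 2
            then have "(r + \<epsilon>) * real n \<le> speed K n \<tau> * real n"
              by (intro mult_right_mono) auto
            then have "ennreal ((r + \<epsilon>) * real n) \<le> ennreal (speed K n \<tau> * real n)"
              by (rule ennreal_leI)
            then show ?thesis using *(2) by simp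
          qed
        qed
        also have "\<dots> \<le> Om.prob {\<tau>. ?T n \<tau> < ennreal (b * real n)}
            + Om.prob {\<tau>. ennreal ((r + \<epsilon>) * real n) \<le> ?T n \<tau>}"
          by (rule measure_Un_le[OF ev])
        finally show ?case .
      qed
    qed auto
  qed
  show "(\<lambda>n. measure (fpp_measure d K P) {\<tau> \<in> space (fpp_measure d K P). ereal (speed K n \<tau>) \<notin> U})
      \<longlonglongrightarrow> 0"
    unfolding eq by (rule lim)
qed

end

text \<open>
  Disjoint neighbourhoods of two limits would both have to carry almost all of the mass.
\<close>

lemma tendsto_in_prob_unique:
  assumes "prob_space M" "tendsto_in_prob M X a" "tendsto_in_prob M X b"
  shows "a = b"
proof (rule ccontr)
  interpret prob_space M by fact
  assume "a \<noteq> b"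
  then obtain U V where UV: "open U" "open V" "a \<in> U" "b \<in> V" "U \<inter> V = {}"
    using hausdorff[OF \<open>a \<noteq> b\<close>] by auto
  have meas: "X n \<in> borel_measurable M" for n
    using assms(2) by (simp add: tendsto_in_prob_def)
  have ev: "{\<omega> \<in> space M. ereal (X n \<omega>) \<notin> W} \<in> events" if "open W" for W n
  proof -
    have "(\<lambda>\<omega>. ereal (X n \<omega>)) \<in> borel_measurable M"
      using meas by simp
    then have "(\<lambda>\<omega>. ereal (X n \<omega>)) -` (- W) \<inter> space M \<in> events"
      using that by (intro measurable_sets) auto
    then show ?thesis by (simp add: vimage_def Int_def conj_commute)
  qed
  have "(\<lambda>n. prob {\<omega> \<in> space M. ereal (X n \<omega>) \<notin> U} + prob {\<omega> \<in> space M. ereal (X n \<omega>) \<notin> V})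
      \<longlonglongrightarrow> 0 + 0"
    using assms(2,3) UV by (intro tendsto_add) (auto simp: tendsto_in_prob_def)
  moreover have "1 \<le> prob {\<omega> \<in> space M. ereal (X n \<omega>) \<notin> U} + prob {\<omega> \<in> space M. ereal (X n \<omega>) \<notin> V}"
    for n
  proof -
    have "{\<omega> \<in> space M. ereal (X n \<omega>) \<notin> U} \<union> {\<omega> \<in> space M. ereal (X n \<omega>) \<notin> V} = space M"
      using UV by auto
    then show ?thesis
      using measure_Un_le[OF ev[OF UV(1)] ev[OF UV(2)], of n n] by (simp add: prob_space)
  qed
  ultimately have "1 \<le> (0::real) + 0"
    by (intro LIMSEQ_le_const[where x = "0 + 0"]) auto
  then show False by simp
qed

context passage_environment
begin

lemma time_constant_eq_rate:
  assumes "K > 0"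
  shows "time_constant d K P = enn2ereal (rate K)"
  unfolding time_constant_def
proof (rule the_equality)
  show *: "tendsto_in_prob (fpp_measure d K P) (speed K) (enn2ereal (rate K))"
    by (rule tendsto_in_prob_speed[OF assms])
  have "prob_space (fpp_measure d K P)"
    unfolding fpp_measure_def by (intro prob_space_PiM P.prob_space_axioms)
  then show "\<mu> = enn2ereal (rate K)" if "tendsto_in_prob (fpp_measure d K P) (speed K) \<mu>" for \<mu>
    using tendsto_in_prob_unique that * by blast
qed

end

section \<open>Finite speed from edge-disjoint paths\<close>

lemma nn_integral_less_top:
  fixes f :: "'a \<Rightarrow> real"
  assumes "integrable M f"
  shows "(\<integral>\<^sup>+x. ennreal (f x) \<partial>M) < \<top>"
proof -
  have "(\<integral>\<^sup>+x. ennreal (f x) \<partial>M) \<le> (\<integral>\<^sup>+x. ennreal (norm (f x)) \<partial>M)"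
    by (intro nn_integral_mono ennreal_leI) auto
  also have "\<dots> < \<top>"
    using assms by (simp add: integrable_iff_bounded)
  finally show ?thesis .
qed

context passage_environment
begin

text \<open>
  Walking from \<open>x\<close> to its translates one unit at a time gives a subadditive upper bound with
  stationary increments.
\<close>

lemma rate_le:
  assumes "K > 0" "x \<in> tube_column d K 0"
  shows "rate K \<le> (\<integral>\<^sup>+\<tau>. pdist d K (wt \<tau>) x (translate 1 x) \<partial>Om)" (is "_ \<le> ?C")
  unfolding rate_def
proof (rule SUP_least)
  fix n :: nat assume "n \<in> {1..}"
  have x: "x \<in> tube_vertices d K" "x 0 = 0"
    using assms by (auto simp: tube_column_def)
  have step: "(\<integral>\<^sup>+\<tau>. pdist d K (wt \<tau>) (translate s x) (translate (1 + s) x) \<partial>Om) = ?C" for s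
  proof -
    have "?C = (\<integral>\<^sup>+\<tau>. pdist d K (wt \<tau>) x (translate 1 x) \<partial>distr Om Om (shift_weight s))"
      by (simp add: distr_shift)
    also have "\<dots> = (\<integral>\<^sup>+\<tau>. pdist d K (wt (shift_weight s \<tau>)) x (translate 1 x) \<partial>Om)"
      by (rule nn_integral_distr) auto
    finally show ?thesis
      by (simp add: wt_shift_weight pdist_shift[OF d_pos] add.commute)
  qed
  have chain: "pdist d K w x (translate (int n) x)
      \<le> (\<Sum>i<n. pdist d K w (translate (int i) x) (translate (1 + int i) x))" for w n
  proof (induction n)
    case (Suc n)
    have "pdist d K w x (translate (int (Suc n)) x) \<le>
        pdist d K w x (translate (int n) x) + pdist d K w (translate (int n) x) (translate (1 + int n) x)"
      using pdist_triangle[of d K w x "translate (1 + int n) x" "translate (int n) x"] by simp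
    then show ?case
      using Suc by (auto intro: order_trans add_right_mono)
  qed (use x in simp)
  have "mean_cross K n \<le> (\<integral>\<^sup>+\<tau>. pdist d K (wt \<tau>) x (translate (int n) x) \<partial>Om)"
    unfolding mean_cross_def using x d_pos by (intro nn_integral_mono cross_le_pdist) auto
  also have "\<dots> \<le> (\<integral>\<^sup>+\<tau>. (\<Sum>i<n. pdist d K (wt \<tau>) (translate (int i) x) (translate (1 + int i) x)) \<partial>Om)"
    by (intro nn_integral_mono chain)
  also have "\<dots> = (\<Sum>i<n. ?C)"
    by (subst nn_integral_sum) (simp_all add: step)
  finally have "mean_cross K n / of_nat n \<le> of_nat n * ?C / of_nat n"
    by (intro divide_right_mono_ennreal) simp
  also have "\<dots> = ?C"
    using \<open>n \<in> {1..}\<close> by (simp add: ennreal_mult_divide_eq mult.commute[of "of_nat n"])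
  finally show "mean_cross K n / of_nat n \<le> ?C" .
qed

lemma nn_integral_reindex:
  assumes "inj_on f I" "h \<in> borel_measurable (Pi\<^sub>M I (\<lambda>_. P))"
  shows "(\<integral>\<^sup>+\<tau>. h (\<lambda>i\<in>I. \<tau> (f i)) \<partial>Om) = (\<integral>\<^sup>+y. h y \<partial>Pi\<^sub>M I (\<lambda>_. P))"
proof -
  have "(\<integral>\<^sup>+y. h y \<partial>Pi\<^sub>M I (\<lambda>_. P)) = (\<integral>\<^sup>+y. h y \<partial>distr Om (Pi\<^sub>M I (\<lambda>_. P)) (\<lambda>\<tau>. \<lambda>i\<in>I. \<tau> (f i)))"
    using distr_Om_reindex[OF assms(1)] by simp
  also have "\<dots> = (\<integral>\<^sup>+\<tau>. h (\<lambda>i\<in>I. \<tau> (f i)) \<partial>Om)"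
    by (rule nn_integral_distr[OF measurable_Om_reindex]) (simp add: assms)
  finally show ?thesis by simp
qed

lemma rate_finite_integrable:
  assumes "K > 0" "integrable P (\<lambda>x. x)"
  shows "rate K < \<top>"
proof -
  let ?e = "{axis_vertex 0, axis_vertex 1}"
  have "neighbours d (axis_vertex 0) (axis_vertex 1)"
    using neighbours_upd[of 0 d "axis_vertex 0" 1] d_pos by (simp add: axis_vertex_def fun_upd_def if_distrib cong: if_cong)
  then have "pdist d K w (axis_vertex 0) (axis_vertex 1) \<le> w ?e" for w
    using d_pos assms by (intro pdist_edge) auto
  then have "(\<integral>\<^sup>+\<tau>. pdist d K (wt \<tau>) (axis_vertex 0) (translate 1 (axis_vertex 0)) \<partial>Om) \<le> (\<integral>\<^sup>+\<tau>. wt \<tau> ?e \<partial>Om)"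
    by (intro nn_integral_mono) simp
  also have "\<dots> = (\<integral>\<^sup>+x. ennreal x \<partial>distr Om P (\<lambda>\<tau>. \<tau> ?e))"
    unfolding wt_def by (subst nn_integral_distr) (auto intro: measurable_component_singleton)
  also have "distr Om P (\<lambda>\<tau>. \<tau> ?e) = P"
    using distr_PiM_component[of UNIV "\<lambda>_. P" ?e] P.prob_space_axioms by simp
  also have "(\<integral>\<^sup>+x. ennreal x \<partial>P) < \<top>"
    by (rule nn_integral_less_top[OF assms(2)])
  finally show ?thesis
    using rate_le[OF assms(1), of "axis_vertex 0"] d_pos assms by (auto intro: le_less_trans)
qed

end

text \<open>
  In the central row all lateral coordinates are \<open>1\<close>. The edge-disjoint paths below only visit
  vertices that are displaced from it in a single lateral direction \<open>i\<close>.
\<close>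

definition off_centre :: "nat \<Rightarrow> int \<Rightarrow> nat \<Rightarrow> int \<Rightarrow> vertex" where
  "off_centre d a i b = (\<lambda>j. if j = 0 then a else if j = i then b else if j < d then 1 else 0)"

lemma off_centre_in_tube:
  "1 \<le> i \<Longrightarrow> i < d \<Longrightarrow> 0 \<le> b \<Longrightarrow> b < int K \<Longrightarrow> 2 \<le> K \<Longrightarrow> off_centre d a i b \<in> tube_vertices d K"
  by (auto simp: off_centre_def tube_vertices_def)

lemma off_centre_one: "1 \<le> i \<Longrightarrow> i < d \<Longrightarrow> off_centre d a i 1 = off_centre d a 1 1"
  by (auto simp: off_centre_def)

lemma neighbours_off_centre:
  assumes "1 \<le> i" "i < d" "\<bar>a - a'\<bar> = 1 \<and> b = b' \<or> a = a' \<and> \<bar>b - b'\<bar> = 1"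
  shows "neighbours d (off_centre d a i b) (off_centre d a' i b')"
proof -
  have "neighbours d (off_centre d a i b) (off_centre d a' i b)" if "\<bar>a - a'\<bar> = 1"
  proof -
    have "(off_centre d a i b)(0 := a') = off_centre d a' i b"
      by (auto simp: off_centre_def)
    then show ?thesis
      using neighbours_upd[of 0 d "off_centre d a i b" a'] assms that by (simp add: off_centre_def)
  qed
  moreover have "neighbours d (off_centre d a i b) (off_centre d a i b')" if "\<bar>b - b'\<bar> = 1"
  proof -
    have "(off_centre d a i b)(i := b') = off_centre d a i b'"
      using assms by (auto simp: off_centre_def)
    then show ?thesis
      using neighbours_upd[of i d "off_centre d a i b" b'] assms that by (simp add: off_centre_def)
  qed
  ultimately show ?thesis
    using assms(3) by blast
qed

text \<open>
  There are \<open>2 d\<close> edge-disjoint ways to proceed by one unit along the tube from a point with lateral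
  coordinates \<open>1\<close>. Path \<open>0\<close> is the direct edge. Paths \<open>2 i\<close> and \<open>2 i + 1\<close> first step sideways, up or
  down in direction \<open>i\<close>. Path \<open>1\<close> starts backwards, climbs to lateral coordinate \<open>3\<close>, passes over
  the others and reaches the end point from the far side; it is the one that needs width \<open>4\<close>.
\<close>

definition disjoint_path :: "nat \<Rightarrow> nat \<Rightarrow> vertex list" where
  "disjoint_path d j =
     (if j = 0 then [off_centre d 0 1 1, off_centre d 1 1 1]
      else if j = 1 then map (\<lambda>(a, b). off_centre d a 1 b)
        [(0, 1), (-1, 1), (-1, 2), (-1, 3), (0, 3), (1, 3), (2, 3), (2, 2), (2, 1), (1, 1)]
      else map (\<lambda>(a, b). off_centre d a (j div 2) b)
        [(0, 1), (0, if even j then 2 else 0), (1, if even j then 2 else 0), (1, 1)])"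

text \<open>
  On the paths above, the tag of a vertex that differs from the two end points is the index of the
  path that uses it, and the tag of the end points is \<open>0\<close>. The largest tag on an edge thus recovers
  the path to which the edge belongs, which proves that the paths are edge-disjoint without a
  comparison of all pairs.
\<close>

definition vertex_tag :: "nat \<Rightarrow> vertex \<Rightarrow> nat" where
  "vertex_tag d x = (if x 0 < 0 \<or> 1 < x 0 \<or> x 1 = 3 then 1
     else \<Sum>i\<in>{1..<d}. if x i = 2 then 2 * i else if x i = 0 then 2 * i + 1 else 0)"

lemma vertex_tag_off_centre:
  assumes "1 \<le> i" "i < d"
  shows "vertex_tag d (off_centre d a i b) = (if a < 0 \<or> 1 < a \<or> i = 1 \<and> b = 3 then 1
     else if b = 2 then 2 * i else if b = 0 then 2 * i + 1 else 0)"
proof -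
  let ?x = "off_centre d a i b"
  have sum: "(\<Sum>k\<in>{1..<d}. if ?x k = 2 then 2 * k else if ?x k = 0 then 2 * k + 1 else 0) =
      (if b = 2 then 2 * i else if b = 0 then 2 * i + 1 else 0)"
  proof -
    have "(\<Sum>k\<in>{1..<d}. if ?x k = 2 then 2 * k else if ?x k = 0 then 2 * k + 1 else 0) =
        (\<Sum>k\<in>{1..<d}. if k = i then if b = 2 then 2 * i else if b = 0 then 2 * i + 1 else 0 else 0)"
      by (intro sum.cong) (auto simp: off_centre_def)
    then show ?thesis using assms by simp
  qed
  have x: "?x 0 = a" "?x 1 = 3 \<longleftrightarrow> i = 1 \<and> b = 3"
    using assms by (auto simp: off_centre_def)
  show ?thesis
    unfolding vertex_tag_def sum x by auto
qed

lemma disjoint_path_lateral: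
  assumes "j \<noteq> 0" "j \<noteq> 1" "j < 2 * d"
  obtains i b where "1 \<le> i" "i < d" "b = 0 \<or> b = 2" "j = (if b = 2 then 2 * i else 2 * i + 1)"
    "disjoint_path d j = [off_centre d 0 1 1, off_centre d 0 i b, off_centre d 1 i b, off_centre d 1 1 1]"
proof -
  have i: "1 \<le> j div 2" "j div 2 < d"
    using assms by auto
  show ?thesis
    by (rule that[of "j div 2" "if even j then 2 else 0"])
       (use assms i off_centre_one[OF i] in \<open>auto simp: disjoint_path_def\<close>)
qed

lemma disjoint_path_in_tube_paths:
  assumes "d \<ge> 2" "K \<ge> 4" "j < 2 * d"
  shows "disjoint_path d j \<in> tube_paths d K (off_centre d 0 1 1) (off_centre d 1 1 1)"
proof (cases "j = 0 \<or> j = 1")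
  case True
  then show ?thesis
    using assms by (auto simp: disjoint_path_def tube_paths_def off_centre_in_tube neighbours_off_centre)
next
  case False
  then obtain i b where i: "1 \<le> i" "i < d" and b: "b = 0 \<or> b = 2" and
    path: "disjoint_path d j = [off_centre d 0 1 1, off_centre d 0 i b, off_centre d 1 i b, off_centre d 1 1 1]"
    using disjoint_path_lateral[of j d] assms by metis
  have "neighbours d (off_centre d 0 1 1) (off_centre d 0 i b)"
    "neighbours d (off_centre d 1 i b) (off_centre d 1 1 1)"
    using neighbours_off_centre[OF i, of 0 0 1 b] neighbours_off_centre[OF i, of 1 1 b 1]
      off_centre_one[OF i] b by auto
  moreover have "neighbours d (off_centre d 0 i b) (off_centre d 1 i b)"
    using i by (intro neighbours_off_centre) auto
  moreover have "off_centre d a i b \<in> tube_vertices d K" for a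
    using assms b by (intro off_centre_in_tube i) auto
  moreover have "off_centre d a 1 1 \<in> tube_vertices d K" for a
    using assms by (intro off_centre_in_tube) auto
  ultimately show ?thesis
    unfolding path by (simp add: tube_paths_def)
qed

lemma disjoint_path_edge_tag:
  assumes "d \<ge> 2" "j < 2 * d" "e \<in> set (path_edges (disjoint_path d j))"
  shows "Max (vertex_tag d ` e) = j"
proof -
  consider "j = 0" | "j = 1" | "j \<noteq> 0" "j \<noteq> 1"
    by metis
  then show ?thesis
  proof cases
    case 3
    obtain i b where i: "1 \<le> i" "i < d" and b: "b = 0 \<or> b = 2" and
      j: "j = (if b = 2 then 2 * i else 2 * i + 1)" and
      path: "disjoint_path d j = [off_centre d 0 1 1, off_centre d 0 i b, off_centre d 1 i b, off_centre d 1 1 1]"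
      by (rule disjoint_path_lateral[OF 3 assms(2)])
    have "vertex_tag d (off_centre d a 1 1) = 0" "vertex_tag d (off_centre d a i b) = j"
      if "a = 0 \<or> a = 1" for a
      using that vertex_tag_off_centre[of 1 d a 1] vertex_tag_off_centre[OF i, of a b] assms(1) b j
      by (auto split: if_splits)
    then show ?thesis
      using assms(3) unfolding path by auto
  qed (use assms in \<open>auto simp: disjoint_path_def vertex_tag_off_centre\<close>)
qed

lemma length_disjoint_path: "length (path_edges (disjoint_path d j)) \<le> 9"
  by (simp add: disjoint_path_def)

lemma disjoint_path_edges_nonempty: "path_edges (disjoint_path d j) \<noteq> []"
  by (simp add: disjoint_path_def)

context passage_environment
begin

text \<open>
  Each path takes at most \<open>9\<close> times the passage time of its slowest edge. The minimum over the paths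
  of the slowest edge is the minimum over a choice \<open>\<sigma>\<close> of one edge per path, and is bounded
  by the sum over all choices. As the paths are edge-disjoint, each term of this sum is a minimum of
  \<open>2 d\<close> independent passage times.
\<close>

lemma rate_finite_min:
  assumes "d \<ge> 2" "K \<ge> 4" and int: "integrable (\<Pi>\<^sub>M i\<in>{..<2 * d}. P) (\<lambda>y. MIN i\<in>{..<2 * d}. y i)"
  shows "rate K < \<top>"
proof -
  let ?J = "{..<2 * d}" and ?c = "off_centre d 0 1 1" and ?c' = "off_centre d 1 1 1"
  let ?E = "\<lambda>j. set (path_edges (disjoint_path d j))"
  let ?\<Sigma> = "Pi\<^sub>E ?J ?E"
  have "0 \<in> ?J" using assms by auto
  then have J: "finite ?J" "?J \<noteq> {}" by blast+
  have fin: "finite ?\<Sigma>" by (intro finite_PiE) auto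
  have pdist_le: "pdist d K (wt \<tau>) ?c ?c' \<le> (\<Sum>\<sigma>\<in>?\<Sigma>. 9 * ennreal (MIN j\<in>?J. \<tau> (\<sigma> j)))" for \<tau>
  proof -
    \<comment> \<open>the choice that picks the slowest edge of each path\<close>
    have "\<forall>j. \<exists>e. e \<in> ?E j \<and> (\<forall>e'\<in>?E j. wt \<tau> e' \<le> wt \<tau> e)"
    proof
      fix j
      have "Max (wt \<tau> ` ?E j) \<in> wt \<tau> ` ?E j"
        using disjoint_path_edges_nonempty by (intro Max_in) auto
      then obtain e where "e \<in> ?E j" "wt \<tau> e = Max (wt \<tau> ` ?E j)" by auto
      then show "\<exists>e. e \<in> ?E j \<and> (\<forall>e'\<in>?E j. wt \<tau> e' \<le> wt \<tau> e)" by (intro exI[of _ e]) auto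
    qed
    from choice[OF this] obtain m where
      m: "\<And>j. m j \<in> ?E j" "\<And>j e. e \<in> ?E j \<Longrightarrow> wt \<tau> e \<le> wt \<tau> (m j)"
      by blast
    define \<sigma> where "\<sigma> = restrict m ?J"
    have "\<sigma> \<in> ?\<Sigma>" using m by (auto simp: \<sigma>_def)
    have "(MIN j\<in>?J. \<tau> (\<sigma> j)) \<in> (\<lambda>j. \<tau> (\<sigma> j)) ` ?J"
      using J by (intro Min_in) auto
    then obtain j where j': "j \<in> ?J" "(MIN j\<in>?J. \<tau> (\<sigma> j)) = \<tau> (\<sigma> j)"
      by (elim imageE)
    then have j: "j < 2 * d" "(MIN j\<in>?J. \<tau> (\<sigma> j)) = \<tau> (m j)"
      by (simp_all add: \<sigma>_def)
    have "pdist d K (wt \<tau>) ?c ?c' \<le> (\<Sum>e\<leftarrow>path_edges (disjoint_path d j). wt \<tau> e)"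
      unfolding pdist_def using disjoint_path_in_tube_paths[OF assms(1,2) j(1)] by (rule INF_lower)
    also have "\<dots> \<le> (\<Sum>e\<leftarrow>path_edges (disjoint_path d j). wt \<tau> (m j))"
      using m(2) by (intro sum_list_mono) auto
    also have "\<dots> = of_nat (length (path_edges (disjoint_path d j))) * wt \<tau> (m j)"
      by (simp add: sum_list_triv)
    also have "\<dots> \<le> of_nat 9 * wt \<tau> (m j)"
      using length_disjoint_path by (intro mult_right_mono of_nat_mono) auto
    also have "\<dots> = 9 * ennreal (MIN j\<in>?J. \<tau> (\<sigma> j))"
      unfolding j(2) by (simp add: wt_def)
    also have "\<dots> \<le> (\<Sum>\<sigma>\<in>?\<Sigma>. 9 * ennreal (MIN j\<in>?J. \<tau> (\<sigma> j)))"
      using fin \<open>\<sigma> \<in> ?\<Sigma>\<close> by (intro member_le_sum) auto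
    finally show ?thesis .
  qed
  have meas: "(\<lambda>y. MIN i\<in>?J. y i) \<in> borel_measurable (Pi\<^sub>M ?J (\<lambda>_. P))"
    using int by (rule borel_measurable_integrable)
  have inj: "inj_on \<sigma> ?J" if "\<sigma> \<in> ?\<Sigma>" for \<sigma>
  proof (rule inj_onI)
    fix i j assume ij: "i \<in> ?J" "j \<in> ?J" "\<sigma> i = \<sigma> j"
    have "Max (vertex_tag d ` \<sigma> i) = i" "Max (vertex_tag d ` \<sigma> j) = j"
      using ij(1,2) PiE_mem[OF that ij(1)] PiE_mem[OF that ij(2)]
      by (simp_all only: disjoint_path_edge_tag[OF assms(1)] lessThan_iff)
    then show "i = j"
      using ij(3) by metis
  qed
  have Min_restrict: "(MIN j\<in>?J. (\<lambda>j\<in>?J. \<tau> (\<sigma> j)) j) = (MIN j\<in>?J. \<tau> (\<sigma> j))"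
    for \<sigma> and \<tau> :: "vertex set \<Rightarrow> real"
    by (rule arg_cong[where f = Min]) (rule image_cong, simp_all)
  have int_\<sigma>: "(\<integral>\<^sup>+\<tau>. ennreal (MIN j\<in>?J. \<tau> (\<sigma> j)) \<partial>Om) = (\<integral>\<^sup>+y. ennreal (MIN i\<in>?J. y i) \<partial>Pi\<^sub>M ?J (\<lambda>_. P))"
    if "\<sigma> \<in> ?\<Sigma>" for \<sigma>
    using nn_integral_reindex[OF inj[OF that], of "\<lambda>y. ennreal (MIN i\<in>?J. y i)"] meas
    unfolding Min_restrict by simp
  have meas_\<sigma>: "(\<lambda>\<tau>. ennreal (MIN j\<in>?J. \<tau> (\<sigma> j))) \<in> borel_measurable Om" for \<sigma>
    using measurable_compose[OF measurable_Om_reindex[where I = ?J and f = \<sigma>] meas]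
    unfolding Min_restrict by simp
  have "(\<integral>\<^sup>+\<tau>. pdist d K (wt \<tau>) ?c (translate 1 ?c) \<partial>Om)
      \<le> (\<integral>\<^sup>+\<tau>. (\<Sum>\<sigma>\<in>?\<Sigma>. 9 * ennreal (MIN j\<in>?J. \<tau> (\<sigma> j))) \<partial>Om)"
  proof (rule nn_integral_mono)
    have "translate 1 ?c = ?c'"
      by (auto simp: translate_def off_centre_def)
    then show "pdist d K (wt \<tau>) ?c (translate 1 ?c) \<le> (\<Sum>\<sigma>\<in>?\<Sigma>. 9 * ennreal (MIN j\<in>?J. \<tau> (\<sigma> j)))" for \<tau>
      using pdist_le by simp
  qed
  also have "\<dots> = (\<Sum>\<sigma>\<in>?\<Sigma>. 9 * (\<integral>\<^sup>+\<tau>. ennreal (MIN j\<in>?J. \<tau> (\<sigma> j)) \<partial>Om))"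
    by (simp only: nn_integral_sum nn_integral_cmult borel_measurable_times_ennreal borel_measurable_const meas_\<sigma>)
  also have "\<dots> = (\<Sum>\<sigma>\<in>?\<Sigma>. 9 * (\<integral>\<^sup>+y. ennreal (MIN i\<in>?J. y i) \<partial>Pi\<^sub>M ?J (\<lambda>_. P)))"
    using int_\<sigma> by (intro sum.cong) auto
  also have "\<dots> < \<top>"
  proof -
    note nn_integral_less_top[OF int]
    then show ?thesis
      by (simp add: ennreal_mult_less_top of_nat_less_top)
  qed
  finally have "(\<integral>\<^sup>+\<tau>. pdist d K (wt \<tau>) ?c (translate 1 ?c) \<partial>Om) < \<top>" .
  moreover have "?c \<in> tube_column d K 0"
    using assms by (auto simp: tube_column_def intro!: off_centre_in_tube) (simp add: off_centre_def)
  ultimately show ?thesis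
    using le_less_trans[OF rate_le[of K ?c]] assms(2) by simp
qed

end

section \<open>Shortcuts through the extra layer\<close>

text \<open>
  If the distribution function only takes the values \<open>0\<close> and \<open>1\<close>, then all the mass sits where it
  jumps. Otherwise it lies strictly between \<open>0\<close> and \<open>1\<close> at some \<open>a\<close>, and some of the mass above \<open>a\<close>
  stays away from \<open>a\<close>.
\<close>

lemma (in real_distribution) exists_separated_values:
  assumes "\<not> (\<exists>c. prob {c} = 1)"
  obtains a b where "a < b" "prob {..a} > 0" "prob {b..} > 0"
proof -
  have "\<exists>x. 0 < cdf M x \<and> cdf M x < 1"
  proof (rule ccontr)
    assume "\<not> ?thesis"
    then have zero_one: "cdf M x = 0 \<or> cdf M x = 1" for x
      using cdf_nonneg[of x] cdf_bounded_prob[of x] by (metis order_le_less)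
    define S where "S = {x. cdf M x = 1}"
    have "eventually (\<lambda>x. cdf M x > 0) at_top"
      using cdf_lim_at_top_prob by (rule order_tendstoD) simp
    then obtain x1 where "cdf M x1 > 0"
      by (auto simp: eventually_at_top_linorder)
    then have x1: "x1 \<in> S" using zero_one[of x1] by (auto simp: S_def)
    have "eventually (\<lambda>x. cdf M x < 1) at_bot"
      using cdf_lim_at_bot by (rule order_tendstoD) simp
    then obtain x0 where x0: "\<And>x. x \<le> x0 \<Longrightarrow> cdf M x < 1"
      by (auto simp: eventually_at_bot_linorder)
    have bdd: "bdd_below S"
    proof (rule bdd_belowI)
      fix x assume "x \<in> S"
      then show "x0 \<le> x"
        using x0[of x] by (cases "x \<le> x0") (auto simp: S_def)
    qed
    define c where "c = Inf S"
    have above: "cdf M x = 1" if "c < x" for x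
    proof -
      have "S \<noteq> {}" using x1 by auto
      then obtain y where "y \<in> S" "y < x"
        using cInf_lessD[of S x] \<open>c < x\<close> by (auto simp: c_def)
      then show ?thesis
        using cdf_nondecreasing[of y x] cdf_bounded_prob[of x] by (auto simp: S_def)
    qed
    have below: "cdf M x = 0" if "x < c" for x
    proof -
      have "x \<notin> S" using that cInf_lower[OF _ bdd, of x] unfolding c_def by auto
      then show ?thesis using zero_one[of x] by (auto simp: S_def)
    qed
    have "cdf M c = 1"
    proof (rule tendsto_unique[of "at_right c"])
      show "(cdf M \<longlongrightarrow> cdf M c) (at_right c)"
        using cdf_is_right_cont[of c] by (simp add: continuous_within)
      show "(cdf M \<longlongrightarrow> 1) (at_right c)"
        by (rule tendsto_eventually) (auto simp: eventually_at_right_field above intro: exI[of _ "c + 1"])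
    qed auto
    moreover have "prob {..<c} = 0"
    proof (rule tendsto_unique[of "at_left c"])
      show "(cdf M \<longlongrightarrow> prob {..<c}) (at_left c)"
        by (rule cdf_at_left)
      show "(cdf M \<longlongrightarrow> 0) (at_left c)"
        by (rule tendsto_eventually) (auto simp: eventually_at_left_field below intro: exI[of _ "c - 1"])
    qed auto
    moreover have "prob {..c} = prob {..<c} + prob {c}"
      by (subst finite_measure_Union[symmetric]) (auto intro: arg_cong[where f = prob])
    ultimately have "prob {c} = 1"
      by (simp add: cdf_def)
    then show False using assms by auto
  qed
  then obtain a where a: "0 < prob {..a}" "prob {..a} < 1"
    by (auto simp: cdf_def)
  have "\<exists>n. prob {a + 1 / real (Suc n)..} > 0"
  proof (rule ccontr)
    assume *: "\<not> ?thesis"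
    have "{a + 1 / real (Suc n)..} \<in> null_sets M" for n
      using * by (intro null_setsI) (auto simp: emeasure_eq_measure not_less measure_le_0_iff)
    then have "(\<Union>n. {a + 1 / real (Suc n)..}) \<in> null_sets M"
      by (rule null_sets_UN)
    moreover have "(\<Union>n. {a + 1 / real (Suc n)..}) = {a<..}"
    proof (intro equalityI subsetI)
      fix x assume "x \<in> {a<..}"
      then obtain n where "inverse (real (Suc n)) < x - a"
        using reals_Archimedean[of "x - a"] by auto
      then show "x \<in> (\<Union>n. {a + 1 / real (Suc n)..})"
        by (auto simp: inverse_eq_divide intro!: exI[of _ n])
    qed (auto intro: less_le_trans[rotated])
    ultimately have "prob {a<..} = 0"
      by (simp add: measure_eq_0_null_sets)
    moreover have "prob {a<..} = 1 - prob {..a}"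
      using prob_compl[of "{..a}"] by (simp add: Compl_eq_Diff_UNIV[symmetric])
    ultimately show False using a by simp
  qed
  then obtain n where "prob {a + 1 / real (Suc n)..} > 0" ..
  with a(1) show ?thesis by (intro that[of a "a + 1 / real (Suc n)"]) auto
qed

text \<open>
  The first \<open>L\<close> columns can be traversed faster by one unit of time if one more layer may be used,
  wherever the traversal starts and ends. The condition is stated in terms of passage times in order
  to be translation covariant and usable without reference to individual edges.
\<close>

definition shortcut :: "nat \<Rightarrow> nat \<Rightarrow> nat \<Rightarrow> (vertex set \<Rightarrow> ennreal) \<Rightarrow> bool" where
  "shortcut d K L w \<longleftrightarrow> (\<forall>u\<in>tube_column d K 0. \<forall>v\<in>tube_column d K (int L).
     1 + pdist d (K + 1) w u v \<le> pdist d K w u v)"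

text \<open>
  The wide tube offers the route via the axis, the row of the extra layer through the vertex
  \<open>(0, K, 0, \<dots>)\<close>, and again the axis: four walks within the two end columns and \<open>L\<close> lengthwise
  edges that lie outside the narrow tube.
\<close>

lemma shortcutI:
  fixes w :: "vertex set \<Rightarrow> ennreal"
  assumes "d \<ge> 2" "K > 0" "0 \<le> a"
    and slow: "\<And>x y. x \<in> tube_vertices d K \<Longrightarrow> y \<in> tube_vertices d K \<Longrightarrow>
      0 \<le> x 0 \<Longrightarrow> y 0 = x 0 + 1 \<Longrightarrow> y 0 \<le> int L \<Longrightarrow> ennreal b \<le> w {x, y}"
    and fast: "\<And>x y. x \<in> tube_vertices d (K + 1) \<Longrightarrow> y \<in> tube_vertices d (K + 1) \<Longrightarrow>
      0 \<le> x 0 \<Longrightarrow> x 0 \<le> int L \<Longrightarrow> 0 \<le> y 0 \<Longrightarrow> y 0 \<le> int L \<Longrightarrow>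
      x 0 = y 0 \<or> x \<notin> tube_vertices d K \<Longrightarrow> w {x, y} \<le> ennreal a"
    and L: "1 + (real L + 4 * real (d * (K + 1))) * a \<le> real L * b"
  shows "shortcut d K L w"
  unfolding shortcut_def
proof (intro ballI)
  fix u v assume u: "u \<in> tube_column d K 0" and v: "v \<in> tube_column d K (int L)"
  let ?V = "tube_vertices d (K + 1)" and ?D = "\<lambda>x y. pdist d (K + 1) w x y"
  let ?B = "of_nat (d * (K + 1)) * ennreal a"
  have uv: "u \<in> ?V" "u 0 = 0" "v \<in> ?V" "v 0 = int L"
    using u v tube_vertices_mono[of K "K + 1" d] by (auto simp: tube_column_def)
  define y where "y = (axis_vertex 0)(1 := int K)"
  have y: "y \<in> ?V" "y 0 = 0" "y 1 = int K"
    using assms by (auto simp: y_def axis_vertex_def tube_vertices_def)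
  have column: "?D x (axis_vertex (x 0)) \<le> ?B" "?D (axis_vertex (x 0)) x \<le> ?B"
    if "x \<in> ?V" "x 0 = 0 \<or> x 0 = int L" for x
  proof -
    have edge: "w {y, z} \<le> ennreal a" if "y \<in> tube_column d (K + 1) (x 0)" "z \<in> tube_column d (K + 1) (x 0)" for y z
      using that \<open>x 0 = 0 \<or> x 0 = int L\<close> by (intro fast) (auto simp: tube_column_def)
    have "d > 0" using assms by simp
    show "?D x (axis_vertex (x 0)) \<le> ?B" "?D (axis_vertex (x 0)) x \<le> ?B"
      using pdist_column_le[of d x "K + 1" w "ennreal a"] \<open>d > 0\<close> \<open>x \<in> ?V\<close> edge by blast+
  qed
  have "?D y (translate (int L) y) \<le> of_nat L * ennreal a"
  proof (rule pdist_row_le)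
    fix j assume "j < L"
    have "translate (int j) y \<notin> tube_vertices d K"
      using tube_coordinate[of "translate (int j) y" d K 1] assms(1) y(3) by (auto simp: translate_def)
    then show "w {translate (int j) y, translate (int (Suc j)) y} \<le> ennreal a"
      using \<open>j < L\<close> y assms by (intro fast) auto
  qed (use y assms in auto)
  moreover have "?D u (axis_vertex 0) \<le> ?B" "?D (axis_vertex 0) y \<le> ?B"
    "?D (translate (int L) y) (axis_vertex (int L)) \<le> ?B" "?D (axis_vertex (int L)) v \<le> ?B"
    using column[of u] column[of y] column[of "translate (int L) y"] column[of v] uv y assms by auto
  moreover have "?D u v \<le> ?D u (axis_vertex 0) + (?D (axis_vertex 0) y + (?D y (translate (int L) y)
      + (?D (translate (int L) y) (axis_vertex (int L)) + ?D (axis_vertex (int L)) v)))"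
    by (meson pdist_triangle add_left_mono order_trans)
  ultimately have "?D u v \<le> ?B + (?B + (of_nat L * ennreal a + (?B + ?B)))"
    by (meson add_mono order_trans)
  also have "\<dots> = ennreal ((real L + 4 * real (d * (K + 1))) * a)"
  proof -
    have nat: "of_nat k * ennreal a = ennreal (real k * a)" for k :: nat
      using assms(3) by (simp add: ennreal_mult'' ennreal_of_nat_eq_real_of_nat)
    have nn: "0 \<le> real k * a" for k using assms(3) by simp
    show ?thesis
      unfolding nat by (simp only: ennreal_plus[symmetric] nn add_nonneg_nonneg) (simp add: algebra_simps)
  qed
  finally have "1 + ?D u v \<le> 1 + ennreal ((real L + 4 * real (d * (K + 1))) * a)"
    by (rule add_left_mono)
  also have "\<dots> = ennreal (1 + (real L + 4 * real (d * (K + 1))) * a)"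
    using assms(3) by (subst ennreal_plus) auto
  also have "\<dots> \<le> ennreal (real L * b)"
    using L by (rule ennreal_leI)
  also have "\<dots> = of_nat (nat (int L - 0)) * ennreal b"
    by (simp add: ennreal_mult' ennreal_of_nat_eq_real_of_nat)
  also have "\<dots> \<le> pdist d K w u v"
    using assms u v by (intro pdist_ge_columns slow) auto
  finally show "1 + ?D u v \<le> pdist d K w u v" .
qed

definition shortcuts :: "nat \<Rightarrow> nat \<Rightarrow> nat \<Rightarrow> nat \<Rightarrow> (vertex set \<Rightarrow> ennreal) \<Rightarrow> nat" where
  "shortcuts d K L m w = (\<Sum>i<m. of_bool (shortcut d K L (shift_weight (int (i * L)) w)))"

text \<open>
  By induction on the number of stretches: the passage time of the narrow tube splits at some vertex
  of the column between two stretches, and the two parts are replaced separately.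
\<close>

lemma pdist_add_shortcuts_le:
  assumes "d > 0" "K > 0" "v \<in> tube_column d K (int (m * L))"
  shows "pdist d (K + 1) w (axis_vertex 0) v + of_nat (shortcuts d K L m w) \<le> pdist d K w (axis_vertex 0) v"
  using assms(3)
proof (induction m arbitrary: v)
  case 0
  then show ?case
    by (simp add: shortcuts_def pdist_tube_mono)
next
  case (Suc m)
  let ?T = "pdist d K w" and ?T' = "pdist d (K + 1) w" and ?s = "int (m * L)"
  let ?Q = "shortcut d K L (shift_weight ?s w)"
  have "?T' (axis_vertex 0) v + of_nat (shortcuts d K L (Suc m) w)
      \<le> (INF u\<in>tube_column d K ?s. ?T (axis_vertex 0) u + ?T u v)"
  proof (rule INF_greatest)
    fix u assume u: "u \<in> tube_column d K ?s"
    have step: "?T' u v + of_bool ?Q \<le> ?T u v"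
    proof (cases ?Q)
      case True
      have "translate (- ?s) u \<in> tube_column d K 0" "translate (- ?s) v \<in> tube_column d K (int L)"
        using u Suc.prems assms by (auto simp: tube_column_def)
      then have "1 + pdist d (K + 1) (shift_weight ?s w) (translate (- ?s) u) (translate (- ?s) v)
          \<le> pdist d K (shift_weight ?s w) (translate (- ?s) u) (translate (- ?s) v)"
        using True by (auto simp: shortcut_def)
      then show ?thesis
        using True assms by (simp add: pdist_shift add.commute)
    qed (simp add: pdist_tube_mono)
    have "?T' (axis_vertex 0) v + of_nat (shortcuts d K L (Suc m) w) \<le>
        (?T' (axis_vertex 0) u + ?T' u v) + of_nat (shortcuts d K L (Suc m) w)"
      by (intro add_right_mono pdist_triangle)
    also have "\<dots> = (?T' (axis_vertex 0) u + of_nat (shortcuts d K L m w)) + (?T' u v + of_bool ?Q)"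
      by (simp add: shortcuts_def ac_simps)
    also have "\<dots> \<le> ?T (axis_vertex 0) u + ?T u v"
      by (intro add_mono Suc.IH u step)
    finally show "?T' (axis_vertex 0) v + of_nat (shortcuts d K L (Suc m) w)
        \<le> ?T (axis_vertex 0) u + ?T u v" .
  qed
  also have "\<dots> \<le> ?T (axis_vertex 0) v"
    using Suc.prems assms by (intro pdist_passthrough) (auto simp: tube_column_def)
  finally show ?case .
qed

context passage_environment
begin

lemma measurable_shortcut [measurable]: "Measurable.pred Om (\<lambda>\<tau>. shortcut d K L (shift_weight s (wt \<tau>)))"
proof -
  have m: "(\<lambda>\<tau>. pdist d K' (shift_weight s (wt \<tau>)) u v) \<in> borel_measurable Om" for K' u v
    by (rule measurable_pdist) (simp add: shift_weight_def)
  have "{\<tau> \<in> space Om. 1 + pdist d (K + 1) (shift_weight s (wt \<tau>)) u v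
      \<le> pdist d K (shift_weight s (wt \<tau>)) u v} \<in> sets Om" for u v
    by (intro borel_measurable_le borel_measurable_add borel_measurable_const m)
  then have "Measurable.pred Om (\<lambda>\<tau>. 1 + pdist d (K + 1) (shift_weight s (wt \<tau>)) u v
      \<le> pdist d K (shift_weight s (wt \<tau>)) u v)" for u v
    by (simp add: pred_def)
  then show ?thesis
    unfolding shortcut_def by (intro pred_intros_finite finite_tube_column)
qed

text \<open>
  The requirements of \<open>shortcutI\<close> concern finitely many independent edges and each is met with
  positive probability.
\<close>

lemma prob_shortcut_pos:
  assumes "d \<ge> 2" "K > 0" and nondegenerate: "\<not> (\<exists>c. measure P {c} = 1)"
  obtains L where "L > 0" "Om.prob {\<tau>. shortcut d K L (wt \<tau>)} > 0"
proof -
  obtain a b where ab: "a < b" "measure P {..a} > 0" "measure P {b..} > 0"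
    using P.exists_separated_values[OF nondegenerate] by blast
  have "0 \<le> a"
  proof (rule ccontr)
    assume "\<not> 0 \<le> a"
    have "AE x in P. x \<notin> {..a}"
      using nonneg by eventually_elim (use \<open>\<not> 0 \<le> a\<close> in auto)
    then have "measure P {..a} = 0"
      by (subst P.prob_eq_0) auto
    then show False using ab by simp
  qed
  define D where "D = 4 * real (d * (K + 1))"
  obtain L0 :: nat where L0: "(1 + D * a) / (b - a) \<le> real L0"
    using real_arch_simple by blast
  define L where "L = Suc L0"
  have "(1 + D * a) / (b - a) \<le> real L" using L0 by (simp add: L_def)
  then have L: "1 + (real L + D) * a \<le> real L * b"
    using ab by (simp add: field_simps)
  define E where "E = (\<lambda>(x, y). {x, y}) ` ({x \<in> tube_vertices d (K + 1). 0 \<le> x 0 \<and> x 0 \<le> int L}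
    \<times> {x \<in> tube_vertices d (K + 1). 0 \<le> x 0 \<and> x 0 \<le> int L})"
  define H where "H = {{x, y} |x y. x \<in> tube_vertices d K \<and> y \<in> tube_vertices d K \<and> y 0 = x 0 + 1}"
  define C where "C e = (if e \<in> H then {b..} else {..a})" for e
  have E: "finite E"
    unfolding E_def by (intro finite_imageI finite_cartesian_product finite_tube_slab)
  have "{\<tau>. \<forall>e\<in>E. \<tau> e \<in> C e} \<subseteq> {\<tau>. shortcut d K L (wt \<tau>)}"
  proof clarify
    fix \<tau> assume \<tau>: "\<forall>e\<in>E. \<tau> e \<in> C e"
    show "shortcut d K L (wt \<tau>)"
    proof (rule shortcutI[OF assms(1,2) \<open>0 \<le> a\<close>])
      fix x y assume xy: "x \<in> tube_vertices d K" "y \<in> tube_vertices d K" "0 \<le> x 0" "y 0 = x 0 + 1" "y 0 \<le> int L"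
      then have "{x, y} \<in> H" by (auto simp: H_def)
      moreover have "{x, y} \<in> E"
        unfolding E_def using xy tube_vertices_mono[of K "K + 1" d] by (intro image_eqI[of _ _ "(x, y)"]) auto
      ultimately show "ennreal b \<le> wt \<tau> {x, y}"
        using \<tau> by (auto simp: wt_def C_def intro!: ennreal_leI)
    next
      fix x y assume xy: "x \<in> tube_vertices d (K + 1)" "y \<in> tube_vertices d (K + 1)"
        "0 \<le> x 0" "x 0 \<le> int L" "0 \<le> y 0" "y 0 \<le> int L" "x 0 = y 0 \<or> x \<notin> tube_vertices d K"
      have "{x, y} \<notin> H"
        using xy(7) by (auto simp: H_def doubleton_eq_iff)
      moreover have "{x, y} \<in> E"
        unfolding E_def using xy by (intro image_eqI[of _ _ "(x, y)"]) auto
      ultimately show "wt \<tau> {x, y} \<le> ennreal a"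
        using \<tau> by (auto simp: wt_def C_def intro!: ennreal_leI)
    next
      show "1 + (real L + 4 * real (d * (K + 1))) * a \<le> real L * b"
        using L by (simp only: D_def)
    qed
  qed
  then have "Om.prob {\<tau>. \<forall>e\<in>E. \<tau> e \<in> C e} \<le> Om.prob {\<tau>. shortcut d K L (wt \<tau>)}"
    using measurable_shortcut[of K L 0] by (intro Om.finite_measure_mono events_Collect) auto
  moreover have "Om.prob {\<tau>. \<forall>e\<in>E. \<tau> e \<in> C e} > 0"
  proof -
    interpret product_prob_space "\<lambda>_::vertex set. P" UNIV
      by unfold_locales
    have "emeasure Om {\<tau> \<in> space Om. \<forall>e\<in>E. \<tau> e \<in> C e} = (\<Prod>e\<in>E. emeasure P (C e))"
      using E by (intro emeasure_PiM_Collect) (auto simp: C_def)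
    also have "\<dots> = ennreal (\<Prod>e\<in>E. measure P (C e))"
      by (simp add: P.emeasure_eq_measure prod_ennreal)
    finally have "Om.prob {\<tau>. \<forall>e\<in>E. \<tau> e \<in> C e} = (\<Prod>e\<in>E. measure P (C e))"
      by (simp add: Om.emeasure_eq_measure prod_nonneg)
    also have "\<dots> > 0"
      using ab by (intro prod_pos) (auto simp: C_def)
    finally show ?thesis .
  qed
  ultimately show ?thesis
    by (intro that[of L]) (auto simp: L_def)
qed

text \<open>
  The mean number of shortcuts is \<open>m p\<close>, and their number never exceeds \<open>m\<close>.
\<close>

lemma prob_shortcuts_ge:
  fixes K L m :: nat
  defines "p \<equiv> Om.prob {\<tau>. shortcut d K L (wt \<tau>)}"
  assumes "m > 0"
  shows "p / 2 \<le> Om.prob {\<tau>. real m * (p / 2) \<le> real (shortcuts d K L m (wt \<tau>))}"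
proof -
  define Q where "Q i = {\<tau>. shortcut d K L (shift_weight (int (i * L)) (wt \<tau>))}" for i
  define N where "N \<tau> = real (shortcuts d K L m (wt \<tau>))" for \<tau>
  define C where "C = {\<tau>. real m * (p / 2) \<le> N \<tau>}"
  have N_sum: "N = (\<lambda>\<tau>. \<Sum>i<m. indicat_real (Q i) \<tau>)"
    unfolding N_def shortcuts_def of_nat_sum by (intro ext sum.cong) (auto simp: Q_def indicator_def)
  have Q [measurable]: "Q i \<in> Om.events" for i
    unfolding Q_def by (intro events_Collect measurable_shortcut)
  have int_Q: "integrable Om (indicat_real (Q i))" for i
    using Q by (intro integrable_real_indicator) (simp_all add: Om.emeasure_eq_measure)
  have int_N: "integrable Om N"
    unfolding N_sum by (intro Bochner_Integration.integrable_sum int_Q)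
  have C: "C \<in> Om.events"
    using borel_measurable_le[OF borel_measurable_const borel_measurable_integrable[OF int_N], of "real m * (p / 2)"]
    by (simp only: C_def space_Om UNIV_I simp_thms)
  have int_C: "integrable Om (\<lambda>\<tau>. real m * indicat_real C \<tau>)"
    using C by (intro integrable_mult_right integrable_real_indicator) (simp_all add: Om.emeasure_eq_measure)
  have pQ: "Om.prob (Q i) = p" for i
    using prob_shifted[of "\<lambda>\<tau>. shortcut d K L (wt \<tau>)" "int (i * L)"] measurable_shortcut[of K L 0]
    by (simp add: p_def Q_def wt_shift_weight)
  have "real m * p = (\<Sum>i<m. Om.expectation (indicat_real (Q i)))"
    by (simp add: pQ)
  also have "\<dots> = Om.expectation N"
    unfolding N_sum by (intro Bochner_Integration.integral_sum[symmetric] int_Q)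
  also have "\<dots> \<le> Om.expectation (\<lambda>\<tau>. real m * indicat_real C \<tau> + real m * (p / 2))"
  proof (rule integral_mono[OF int_N Bochner_Integration.integrable_add[OF int_C]])
    fix \<tau>
    have "N \<tau> \<le> (\<Sum>i<m. 1)"
      unfolding N_sum by (intro sum_mono) (auto simp: indicator_def)
    moreover have "0 \<le> real m * (p / 2)" by (simp add: p_def)
    ultimately show "N \<tau> \<le> real m * indicat_real C \<tau> + real m * (p / 2)"
      by (cases "\<tau> \<in> C") (auto simp: C_def)
  qed simp
  also have "\<dots> = real m * Om.prob C + real m * (p / 2)"
    using C Om.prob_space by (subst Bochner_Integration.integral_add[OF int_C]) simp_all
  finally have "real m * (p / 2) \<le> real m * Om.prob C"
    by (simp add: field_simps)
  then have "p / 2 \<le> Om.prob C"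
    using assms(2) by (simp only: mult_le_cancel_left_pos of_nat_0_less_iff)
  then show ?thesis
    by (simp only: C_def N_def)
qed

text \<open>
  Let \<open>r\<close> be the rate of the wide tube. If the rate of the narrow one were at most \<open>r\<close>, then for the
  distance \<open>m L\<close> the passage time of the narrow tube would mostly be below \<open>(r + \<epsilon>) m L\<close> and that of
  the wide tube above \<open>(r - \<epsilon>) m L\<close>, although with probability at least \<open>p / 2\<close> they differ by at
  least \<open>m p / 2\<close>. The choice \<open>\<epsilon> = p / (8 L)\<close> excludes this.
\<close>

lemma rate_strict_antimono:
  assumes "d \<ge> 2" "K > 0" and nondegenerate: "\<not> (\<exists>c. measure P {c} = 1)"
    and finite: "rate (K + 1) < \<top>"
  shows "rate (K + 1) < rate K"
proof (rule ccontr)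
  assume "\<not> rate (K + 1) < rate K"
  then have le: "rate K \<le> rate (K + 1)" by simp
  define r where "r = enn2real (rate (K + 1))"
  have r: "0 \<le> r" "rate (K + 1) = ennreal r"
    using finite by (auto simp: r_def)
  have rK: "rate K < \<top>" "enn2real (rate K) \<le> r"
    using le finite unfolding r_def by (auto intro: enn2real_mono le_less_trans)
  obtain L where L: "L > 0" and "Om.prob {\<tau>. shortcut d K L (wt \<tau>)} > 0"
    using prob_shortcut_pos[OF assms(1-3)] by blast
  define p where "p = Om.prob {\<tau>. shortcut d K L (wt \<tau>)}"
  have p: "p > 0" using \<open>Om.prob _ > 0\<close> by (simp add: p_def)
  define \<epsilon> where "\<epsilon> = p / (8 * real L)"
  have \<epsilon>: "\<epsilon> > 0" "\<epsilon> * real L = p / 8"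
    using p L by (auto simp: \<epsilon>_def)
  define b where "b = max 0 (r - \<epsilon>)"
  have b: "0 \<le> b" "r - \<epsilon> \<le> b" by (auto simp: b_def)
  let ?T = "\<lambda>K m \<tau>. pdist d K (wt \<tau>) (axis_vertex 0) (axis_vertex (int (m * L)))"
  let ?A = "\<lambda>m. {\<tau>. ennreal ((r + \<epsilon>) * real (m * L)) \<le> ?T K m \<tau>}"
  let ?B = "\<lambda>m. {\<tau>. ?T (K + 1) m \<tau> < ennreal (b * real (m * L))}"
  let ?C = "\<lambda>m. {\<tau>. real m * (p / 2) \<le> real (shortcuts d K L m (wt \<tau>))}"
  have sub: "filterlim (\<lambda>m. m * L) at_top at_top"
    using L by (intro filterlim_subseq strict_monoI) auto
  have A: "(\<lambda>m. Om.prob (?A m)) \<longlonglongrightarrow> 0"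
  proof -
    have "enn2real (rate K) < r + \<epsilon>" using rK \<epsilon> by linarith
    from filterlim_compose[OF prob_pdist_ge_tendsto_0[OF assms(2) rK(1) this] sub] show ?thesis .
  qed
  have B: "(\<lambda>m. Om.prob (?B m)) \<longlonglongrightarrow> 0"
  proof (cases "b = 0")
    case False
    then have "b < r" using \<epsilon> r by (auto simp: b_def max_def split: if_splits)
    then have "ennreal b < rate (K + 1)" using r b by (simp add: ennreal_less_iff)
    then show ?thesis
      using filterlim_compose[OF prob_pdist_less_tendsto_0[of "K + 1" b] sub] b by simp
  qed auto
  have "eventually (\<lambda>m. Om.prob (?A m) + Om.prob (?B m) < p / 2) sequentially"
    using tendsto_add[OF A B] p by (intro order_tendstoD(2)) auto
  then have "eventually (\<lambda>m. Om.prob (?A m) + Om.prob (?B m) < p / 2 \<and> m > 0) sequentially"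
    using eventually_gt_at_top by (rule eventually_conj)
  then obtain m where m: "Om.prob (?A m) + Om.prob (?B m) < p / 2" "m > 0"
    by (auto simp: eventually_sequentially)
  have ev: "?A m \<in> Om.events" "?B m \<in> Om.events"
    by (intro events_Collect; measurable)+
  have "\<not> ?C m \<subseteq> ?A m \<union> ?B m"
  proof
    assume "?C m \<subseteq> ?A m \<union> ?B m"
    then have "Om.prob (?C m) \<le> Om.prob (?A m \<union> ?B m)"
      using ev by (intro Om.finite_measure_mono) auto
    also have "\<dots> \<le> Om.prob (?A m) + Om.prob (?B m)"
      using ev by (rule measure_Un_le)
    finally show False
      using m prob_shortcuts_ge[OF m(2), of K L] by (simp add: p_def)
  qed
  then obtain \<tau> where \<tau>: "\<tau> \<in> ?C m" "\<tau> \<notin> ?A m" "\<tau> \<notin> ?B m" by blast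
  let ?N = "shortcuts d K L m (wt \<tau>)"
  have "ennreal (b * real (m * L) + real ?N) = ennreal (b * real (m * L)) + of_nat ?N"
    using b by (subst ennreal_plus) (auto simp: ennreal_of_nat_eq_real_of_nat)
  also have "\<dots> \<le> ?T (K + 1) m \<tau> + of_nat ?N"
    using \<tau>(3) by (intro add_right_mono) auto
  also have "\<dots> \<le> ?T K m \<tau>"
    using d_pos assms by (intro pdist_add_shortcuts_le) auto
  also have "\<dots> < ennreal ((r + \<epsilon>) * real (m * L))"
    using \<tau>(2) by auto
  finally have "b * real (m * L) + real ?N < (r + \<epsilon>) * real (m * L)"
    using b by (subst (asm) ennreal_less_iff) auto
  moreover have "real m * (p / 2) \<le> real ?N"
    using \<tau>(1) by simp
  moreover have "(r - \<epsilon>) * real (m * L) \<le> b * real (m * L)"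
    using b by (intro mult_right_mono) auto
  ultimately have "(r - \<epsilon>) * real (m * L) + real m * (p / 2) < (r + \<epsilon>) * real (m * L)"
    by linarith
  then have "real m * (p / 2) < real m * (2 * (\<epsilon> * real L))"
    by (simp add: algebra_simps)
  then have "real m * (p / 2) < real m * (p / 4)"
    unfolding \<epsilon>(2) by simp
  then show False
    using p by simp
qed

end

theorem proposition5p1:
  fixes d K :: nat and P :: "real measure"
  assumes "d \<ge> 2" and "K \<ge> 1"
    and "real_distribution P"
    and "AE x in P. 0 \<le> x"
    and "\<not> (\<exists>c. measure P {c} = 1)"
    and "integrable P (\<lambda>x. x) \<or>
         (K \<ge> 3 \<and> integrable (\<Pi>\<^sub>M i\<in>{..<2 * d}. P) (\<lambda>y. MIN i\<in>{..<2 * d}. y i))"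
  shows "time_constant d (K + 1) P < time_constant d K P"
proof -
  interpret passage_environment d P
    by (rule passage_environment.intro) (use assms(1,3,4) in auto)
  have "rate (K + 1) < \<top>"
    using assms(6)
  proof
    assume "integrable P (\<lambda>x. x)"
    then show ?thesis by (intro rate_finite_integrable) auto
  next
    assume "K \<ge> 3 \<and> integrable (\<Pi>\<^sub>M i\<in>{..<2 * d}. P) (\<lambda>y. MIN i\<in>{..<2 * d}. y i)"
    then show ?thesis using assms(1) by (intro rate_finite_min) auto
  qed
  then have "rate (K + 1) < rate K"
    using assms by (intro rate_strict_antimono) auto
  then show ?thesis
    using assms(2) by (simp add: time_constant_eq_rate less_ennreal.rep_eq)
qed

end
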